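(* If $P$ is a $d$-dimensional $k\times\cdots\times k$ permutation matrix, or a tuple permutation matrix generated by such a permutation matrix, then $S(P,d)=2^{O(k)}$. Explicitly: for every fixed $d\ge 1$ and every fixed $j\ge 1$ there is a constant $C>0$ such that for every $k\ge 1$ and every $P$ that is a $j$-tuple permutation matrix generated by a $d$-dimensional $k\times\cdots\times k$ permutation matrix (the case $j=1$ being the permutation matrices themselves), $S(P,d)\le 2^{Ck}$.
   Context: A $d$-dimensional $n_1\times\cdots\times n_d$ zero-one matrix is an array $A=(a_{i_1,\ldots,i_d})$, $1\le i_\ell\le n_\ell$, with entries in $\{0,1\}$. A submatrix is obtained by selecting, for each $\ell$, a set of values of the $\ell$-th coordinate (keeping the order). $A$ contains a $d$-dimensional zero-one matrix $B$ if some submatrix of $A$ can be transformed into $B$ by changing any number of ones to zeros; otherwise $A$ avoids $B$. $f(n,B,d)$ denotes the maximum number of ones in a $d$-dimensional $n\times\cdots\times n$ zero-one matrix that avoids $B$, and $$S(P,d)=\limsup_{n\to\infty}\frac{f(n,P,d)}{n^{d-1}}.$$ An $\ell$-cross section is the set of all entries having a fixed value of the $\ell$-th coordinate. A $d$-dimensional $k\times\cdots\times k$ zero-one matrix is a permutation matrix if each of its $\ell$-cross sections contains exactly one nonzero entry, for every $\ell=1,\ldots,d$. $R^{k_1,\ldots,k_d}$ is the $k_1\times\cdots\times k_d$ matrix of all ones, and the Kronecker product $M\otimes N$ is obtained by replacing each $1$-entry of $M$ by a copy of $N$ and each $0$-entry of $M$ by a zero matrix of the same size as $N$. For a permutation matrix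 $P'$, the matrix $P'\otimes R^{k_1,\ldots,k_d}$ is called a $j$-tuple permutation matrix generated by $P'$ if one of $k_1,\ldots,k_d$ equals $j$ and the rest equal $1$; a tuple permutation matrix is a $j$-tuple permutation matrix for some $j\ge 2$. *)

theory Defs
  imports Complex_Main "HOL-Library.Extended_Real"
begin

text \<open>
  A zero-one array is given by its list of side lengths and the set of positions of its
  one-entries. Its dimension is the number of side lengths. Coordinates count from 0, so that
  the value \<open>i\<^sub>l\<close> of a coordinate ranges over \<open>{0..<n\<^sub>l}\<close>.
\<close>

datatype zo_matrix = ZO_Matrix (dims: "nat list") (ones: "nat list set")

definition positions :: "nat list \<Rightarrow> nat list set" where
  "positions ns = {i. list_all2 (<) i ns}"

definition is_matrix :: "nat list \<Rightarrow> zo_matrix \<Rightarrow> bool" where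
  "is_matrix ns A \<longleftrightarrow> dims A = ns \<and> ones A \<subseteq> positions ns"

text \<open>
  The submatrix of \<open>A\<close> on the coordinate values \<open>Ss ! l\<close> in direction \<open>l\<close>; its coordinate
  value \<open>x\<close> in direction \<open>l\<close> stands for the element number \<open>x\<close> of \<open>Ss ! l\<close> in increasing order.
\<close>

definition submatrix :: "zo_matrix \<Rightarrow> nat set list \<Rightarrow> zo_matrix" where
  "submatrix A Ss =
     ZO_Matrix (map card Ss)
       {i \<in> positions (map card Ss). map2 (\<lambda>S x. sorted_list_of_set S ! x) Ss i \<in> ones A}"

definition contains :: "zo_matrix \<Rightarrow> zo_matrix \<Rightarrow> bool" where
  "contains A B \<longleftrightarrow>
     (\<exists>Ss. list_all2 (\<lambda>S n. S \<subseteq> {..<n}) Ss (dims A) \<and>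
           dims (submatrix A Ss) = dims B \<and> ones B \<subseteq> ones (submatrix A Ss))"

abbreviation avoids :: "zo_matrix \<Rightarrow> zo_matrix \<Rightarrow> bool" where
  "avoids A B \<equiv> \<not> contains A B"

text \<open>
  The maximum is over a finite set, which is nonempty as soon as \<open>B\<close> has a one-entry,
  because the zero matrix then avoids \<open>B\<close>.
\<close>

definition extremal :: "nat \<Rightarrow> zo_matrix \<Rightarrow> nat \<Rightarrow> nat" where
  "extremal n B d = Max {card (ones A) | A. is_matrix (replicate d n) A \<and> avoids A B}"

text \<open>The limit superior is an extended real, so an upper bound on it includes its finiteness.\<close>

definition S_limsup :: "zo_matrix \<Rightarrow> nat \<Rightarrow> ereal" where
  "S_limsup P d = limsup (\<lambda>n. ereal (real (extremal n P d) / real n ^ (d - 1)))"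

definition cross_section :: "nat list \<Rightarrow> nat \<Rightarrow> nat \<Rightarrow> nat list set" where
  "cross_section ns l v = {i \<in> positions ns. i ! l = v}"

definition permutation_matrix :: "nat \<Rightarrow> nat \<Rightarrow> zo_matrix \<Rightarrow> bool" where
  "permutation_matrix d k P \<longleftrightarrow>
     is_matrix (replicate d k) P \<and>
     (\<forall>l<d. \<forall>v<k. \<exists>!i. i \<in> cross_section (replicate d k) l v \<and> i \<in> ones P)"

definition all_ones :: "nat list \<Rightarrow> zo_matrix" where
  "all_ones ks = ZO_Matrix ks (positions ks)"

text \<open>The entry of block \<open>a\<close> at inner position \<open>b\<close> has coordinates \<open>a\<^sub>l * n\<^sub>l + b\<^sub>l\<close>.\<close>

definition kronecker :: "zo_matrix \<Rightarrow> zo_matrix \<Rightarrow> zo_matrix" where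
  "kronecker M N =
     ZO_Matrix (map2 (*) (dims M) (dims N))
       {map2 (+) (map2 (*) a (dims N)) b | a b. a \<in> ones M \<and> b \<in> ones N}"

definition tuple_permutation_matrix :: "nat \<Rightarrow> nat \<Rightarrow> zo_matrix \<Rightarrow> zo_matrix \<Rightarrow> bool" where
  "tuple_permutation_matrix d j P' P \<longleftrightarrow>
     (\<exists>l<d. P = kronecker P' (all_ones ((replicate d 1)[l := j])))"

text \<open>The case \<open>j = 1\<close> gives back the permutation matrices themselves.\<close>

lemma tuple_permutation_matrix_1:
  assumes "d \<ge> 1" "is_matrix (replicate d k) P'"
  shows "tuple_permutation_matrix d 1 P' P \<longleftrightarrow> P = P'"
proof -
  have upd: "(replicate d (1::nat))[l := 1] = replicate d 1" for l
    by (metis list_update_id list_update_beyond not_less nth_replicate length_replicate)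
  have pos: "positions (replicate d 1) = {replicate d 0}"
    by (auto simp: positions_def list_all2_conv_all_nth intro: nth_equalityI)
  have mult: "map2 (*) a (replicate d 1) = a" if "length a = d" for a :: "nat list"
    using that by (auto intro: nth_equalityI)
  have add: "map2 (+) a (replicate d 0) = a" if "length a = d" for a :: "nat list"
    using that by (auto intro: nth_equalityI)
  have len: "length a = d" if "a \<in> ones P'" for a
    using that assms(2) by (auto simp: is_matrix_def positions_def dest!: subsetD list_all2_lengthD)
  have block: "map2 (+) (map2 (*) a (replicate d 1)) (replicate d 0) = a" if "a \<in> ones P'" for a
    using len[OF that] by (simp only: mult add)
  have "ones (kronecker P' (all_ones (replicate d 1))) =
      (\<lambda>a. map2 (+) (map2 (*) a (replicate d 1)) (replicate d 0)) ` ones P'"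
    unfolding kronecker_def all_ones_def pos zo_matrix.sel by blast
  also have "\<dots> = ones P'"
    using block by (simp only: image_cong image_ident cong: image_cong)
  finally have "ones (kronecker P' (all_ones (replicate d 1))) = ones P'" .
  moreover have "dims (kronecker P' (all_ones (replicate d 1))) = dims P'"
    unfolding kronecker_def all_ones_def zo_matrix.sel
    using assms(2) by (simp only: is_matrix_def mult length_replicate)
  ultimately have "kronecker P' (all_ones (replicate d 1)) = P'"
    by (simp add: zo_matrix.expand)
  then show ?thesis
    using assms(1) unfolding tuple_permutation_matrix_def upd by (auto intro: exI[of _ 0])
qed

end

theory Submission imports Defs "HOL-Library.FuncSet" begin

text \<open>
  All copies of a pattern generated by a \<open>k \<times> \<dots> \<times> k\<close> permutation matrix are found at once inside a
  stronger configuration: every direction is cut into \<open>k\<close> consecutive intervals, and each of the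
  \<open>k\<^sup>d\<close> resulting boxes contains \<open>j\<close> ones on a common line in the tuple direction \<open>L\<close>. As in Fox's
  argument for \<open>d = 2\<close>, such interval minors are better suited to induction than patterns.

  Splitting the ones by their rank modulo \<open>r\<close> on their line reduces \<open>r + 1\<close> aligned ones to two, at
  the price of a factor \<open>r\<close>. For two aligned ones, contract one direction \<open>c\<close> at a time by a factor
  \<open>t = 2\<^sup>b\<close>. A cell of the contraction is wide if its ones take at least \<open>2\<^sup>O\<^sup>(\<^sup>k\<^sup>)\<close> different
  \<open>c\<close>-values. Repeated halving of a block shows that if a slab contained more than \<open>t\<^sup>2 M\<close> wide cells,
  then more than \<open>M\<close> of them would meet the same consecutive intervals of the block, and a minor in the
  \<open>d - 1\<close> remaining directions would extend to one in \<open>d\<close> directions. Hence there are only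
  \<open>O(n\<^sup>d\<^sup>-\<^sup>1)\<close> wide cells by induction on \<open>d\<close>, while the others lose a factor that is independent
  of \<open>t\<close>. After all \<open>d\<close> contractions the total loss is at most \<open>t\<^sup>d\<^sup>-\<^sup>1 / 2\<^sup>d\<close> if \<open>t\<close> is a suitable
  \<open>2\<^sup>O\<^sup>(\<^sup>k\<^sup>)\<close>, so the recursion in \<open>n\<close> closes up.
\<close>

section \<open>Common labellings of many rows in one block\<close>

text \<open>
  Each halving of the interval costs a factor 4 in the number of rows: the elements of a row lie all
  to the left, all to the right, or on both sides with at least half of them on a known side. In the
  last cases one further label is gained.
\<close>

lemma common_labelling:
  assumes "finite R" "4 ^ b * M < card R"
    and "\<And>r. r \<in> R \<Longrightarrow> T r \<subseteq> {p..<p + 2 ^ b}" "\<And>r. r \<in> R \<Longrightarrow> 2 ^ l \<le> card (T r)"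
  shows "\<exists>R'\<subseteq>R. M < card R' \<and>
    (\<exists>g :: nat \<Rightarrow> nat. mono g \<and> (\<forall>r\<in>R'. \<forall>a\<le>l. \<exists>x\<in>T r. g x = a))"
  using assms
proof (induction b arbitrary: l p R T)
  case 0
  have "2 ^ l \<le> (1::nat)" if "r \<in> R" for r
    using 0(4)[OF that] card_mono[OF _ 0(3)[OF that]] by simp
  moreover have "R \<noteq> {}" using 0(2) by auto
  ultimately have "2 ^ l \<le> (1::nat)" by blast
  then have "l = 0" using one_less_power[of "2::nat" l] by (cases "l = 0") auto
  then have "T r \<noteq> {}" if "r \<in> R" for r using 0(4)[OF that] by auto
  then show ?case using 0(2) \<open>l = 0\<close>
    by (intro exI[of _ R] conjI exI[of _ "\<lambda>_. 0"]) (auto simp: mono_def)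
next
  case (Suc b)
  show ?case
  proof (cases l)
    case 0
    have "T r \<noteq> {}" if "r \<in> R" for r using Suc.prems(4)[OF that] by auto
    moreover have "M < card R"
      using Suc.prems(2) by (rule le_less_trans[rotated]) simp
    ultimately show ?thesis using 0
      by (intro exI[of _ R] conjI exI[of _ "\<lambda>_. 0"]) (auto simp: mono_def)
  next
    case (Suc m)
    define c where "c = p + 2 ^ b"
    define TL where "TL r = T r \<inter> {..<c}" for r
    define TR where "TR r = T r \<inter> {c..}" for r
    have fin: "finite (T r)" if "r \<in> R" for r
      using finite_subset[OF Suc.prems(3)[OF that]] by simp
    have TL: "TL r \<subseteq> {p..<p + 2 ^ b}" if "r \<in> R" for r
      using Suc.prems(3)[OF that] by (auto simp: TL_def c_def)
    have TR: "TR r \<subseteq> {c..<c + 2 ^ b}" if "r \<in> R" for r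
      using Suc.prems(3)[OF that] by (auto simp: TR_def c_def)
    have un: "T r = TL r \<union> TR r" for r by (auto simp: TL_def TR_def)
    have cards: "2 ^ l \<le> card (TL r) + card (TR r)" if "r \<in> R" for r
    proof -
      have "card (T r) \<le> card (TL r) + card (TR r)" by (subst un) (rule card_Un_le)
      then show ?thesis using Suc.prems(4)[OF that] by linarith
    qed
    define R1 where "R1 = {r \<in> R. 2 ^ l \<le> card (TL r)}"
    define R2 where "R2 = {r \<in> R. 2 ^ l \<le> card (TR r)}"
    define R3 where "R3 = {r \<in> R. 2 ^ m \<le> card (TL r) \<and> TR r \<noteq> {}}"
    define R4 where "R4 = {r \<in> R. 2 ^ m \<le> card (TR r) \<and> TL r \<noteq> {}}"
    have "R \<subseteq> (R1 \<union> R2) \<union> (R3 \<union> R4)"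
    proof
      fix r assume r: "r \<in> R"
      show "r \<in> (R1 \<union> R2) \<union> (R3 \<union> R4)"
      proof (cases "TL r = {} \<or> TR r = {}")
        case True
        then show ?thesis using cards[OF r] r by (auto simp: R1_def R2_def)
      next
        case False
        have "2 ^ m \<le> card (TL r) \<or> 2 ^ m \<le> card (TR r)"
          using cards[OF r] Suc by (simp, linarith)
        then show ?thesis using r False by (auto simp: R3_def R4_def)
      qed
    qed
    moreover have "finite R1" "finite R2" "finite R3" "finite R4"
      using Suc.prems(1) by (auto simp: R1_def R2_def R3_def R4_def)
    ultimately have "card R \<le> (card R1 + card R2) + (card R3 + card R4)"
      by (meson add_mono card_Un_le card_mono finite_UnI le_trans)
    \<comment> \<open>Pigeonhole: \<open>R\<close> has more than \<open>4 * (4 ^ b * M)\<close> rows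
      and is covered by four classes, one of which is large enough for the induction hypothesis on a
      half block.\<close>
    then consider "4 ^ b * M < card R1" | "4 ^ b * M < card R2"
      | "4 ^ b * M < card R3" | "4 ^ b * M < card R4"
      using Suc.prems(2) by (simp, linarith)
    then show ?thesis
    proof cases
      case 1
      have "\<exists>R'\<subseteq>R1. M < card R' \<and>
        (\<exists>g :: nat \<Rightarrow> nat. mono g \<and> (\<forall>r\<in>R'. \<forall>a\<le>l. \<exists>x\<in>TL r. g x = a))"
        by (rule Suc.IH[OF \<open>finite R1\<close> 1, where p = p and T = TL and l = l])
          (use TL R1_def in blast)+
      then obtain R' g where "R' \<subseteq> R1" "M < card R'" "mono (g :: nat \<Rightarrow> nat)"
        "\<And>r a. r \<in> R' \<Longrightarrow> a \<le> l \<Longrightarrow> \<exists>x\<in>TL r. g x = a" by blast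
      then show ?thesis
        by (intro exI[of _ R'] conjI exI[of _ g]) (auto simp: R1_def un bex_Un)
    next
      case 2
      have "\<exists>R'\<subseteq>R2. M < card R' \<and>
        (\<exists>g :: nat \<Rightarrow> nat. mono g \<and> (\<forall>r\<in>R'. \<forall>a\<le>l. \<exists>x\<in>TR r. g x = a))"
        by (rule Suc.IH[OF \<open>finite R2\<close> 2, where p = c and T = TR and l = l])
          (use TR R2_def in blast)+
      then obtain R' g where "R' \<subseteq> R2" "M < card R'" "mono (g :: nat \<Rightarrow> nat)"
        "\<And>r a. r \<in> R' \<Longrightarrow> a \<le> l \<Longrightarrow> \<exists>x\<in>TR r. g x = a" by blast
      then show ?thesis
        by (intro exI[of _ R'] conjI exI[of _ g]) (auto simp: R2_def un bex_Un)
    next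
      case 3
      have "\<exists>R'\<subseteq>R3. M < card R' \<and>
        (\<exists>g :: nat \<Rightarrow> nat. mono g \<and> (\<forall>r\<in>R'. \<forall>a\<le>m. \<exists>x\<in>TL r. g x = a))"
        by (rule Suc.IH[OF \<open>finite R3\<close> 3, where p = p and T = TL and l = m])
          (use TL R3_def in blast)+
      then obtain R' g where R': "R' \<subseteq> R3" "M < card R'" and g: "mono g"
        "\<And>r a. r \<in> R' \<Longrightarrow> a \<le> m \<Longrightarrow> \<exists>x\<in>TL r. g x = a" by blast
      \<comment> \<open>Left of \<open>c\<close> the labelling \<open>g\<close> may exceed
        \<open>m\<close>. Truncation at \<open>m\<close> keeps the labels up to \<open>m\<close>
        attained and leaves the top label \<open>l = Suc m\<close> to the right half.\<close>
      define h where "h x = (if x < c then min (g x) m else l)" for x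
      have "mono h"
      proof (rule monoI)
        fix x y :: nat assume "x \<le> y"
        then have "g x \<le> g y" by (rule monoD[OF g(1)])
        then show "h x \<le> h y" using \<open>x \<le> y\<close> Suc by (auto simp: h_def)
      qed
      moreover have "\<exists>x\<in>T r. h x = a" if "r \<in> R'" "a \<le> l" for r a
      proof (cases "a = l")
        case True
        have "TR r \<noteq> {}" using R'(1) that(1) unfolding R3_def by blast
        then obtain x where "x \<in> TR r" by blast
        then show ?thesis using True by (intro bexI[of _ x]) (auto simp: TR_def h_def)
      next
        case False
        then have "a \<le> m" using that Suc by simp
        with g(2)[OF that(1) this] obtain x where "x \<in> TL r" "g x = a" by blast
        then show ?thesis using \<open>a \<le> m\<close>
          by (intro bexI[of _ x]) (auto simp: TL_def h_def)
      qed
      ultimately show ?thesis using R'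
        by (intro exI[of _ R'] conjI exI[of _ h]) (auto simp: R3_def subset_iff)
    next
      case 4
      have "\<exists>R'\<subseteq>R4. M < card R' \<and>
        (\<exists>g :: nat \<Rightarrow> nat. mono g \<and> (\<forall>r\<in>R'. \<forall>a\<le>m. \<exists>x\<in>TR r. g x = a))"
        by (rule Suc.IH[OF \<open>finite R4\<close> 4, where p = c and T = TR and l = m])
          (use TR R4_def in blast)+
      then obtain R' g where R': "R' \<subseteq> R4" "M < card R'" and g: "mono g"
        "\<And>r a. r \<in> R' \<Longrightarrow> a \<le> m \<Longrightarrow> \<exists>x\<in>TR r. g x = a" by blast
      \<comment> \<open>The labels of the right half move up by one, which frees the label 0 for the
        left half.\<close>
      define h where "h x = (if x < c then 0 else Suc (g x))" for x
      have "mono h"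
      proof (rule monoI)
        fix x y :: nat assume "x \<le> y"
        then have "g x \<le> g y" by (rule monoD[OF g(1)])
        then show "h x \<le> h y" using \<open>x \<le> y\<close> by (auto simp: h_def)
      qed
      moreover have "\<exists>x\<in>T r. h x = a" if "r \<in> R'" "a \<le> l" for r a
      proof (cases a)
        case 0
        have "TL r \<noteq> {}" using R'(1) that(1) unfolding R4_def by blast
        then obtain x where "x \<in> TL r" by blast
        then show ?thesis using 0 by (intro bexI[of _ x]) (auto simp: TL_def h_def)
      next
        case (Suc a')
        then have "a' \<le> m" using that \<open>l = Suc m\<close> by simp
        with g(2)[OF that(1) this] obtain x where "x \<in> TR r" "g x = a'" by blast
        then show ?thesis using Suc
          by (intro bexI[of _ x]) (auto simp: TR_def h_def)
      qed
      ultimately show ?thesis using R'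
        by (intro exI[of _ R'] conjI exI[of _ h]) (auto simp: R4_def subset_iff)
    qed
  qed
qed

section \<open>Interval minors with aligned ones\<close>

text \<open>
  The intervals in direction \<open>i\<close> are the level sets of the monotone labelling \<open>g i\<close>; labels that
  are at least \<open>k\<close> are ignored. With labellings, composing a minor with a contraction is composing
  functions. Points are extensional functions on the set \<open>D\<close> of directions, so that dropping a
  direction is \<^const>\<open>restrict\<close>.
\<close>

definition has_minor :: "nat \<Rightarrow> 'i set \<Rightarrow> 'i \<Rightarrow> nat \<Rightarrow> ('i \<Rightarrow> nat) set \<Rightarrow> bool" where
  "has_minor j D L k A \<longleftrightarrow>
     (\<exists>g :: 'i \<Rightarrow> nat \<Rightarrow> nat. (\<forall>i. mono (g i)) \<and>
       (\<forall>a \<in> D \<rightarrow> {..<k}. \<exists>x Y. card Y = j \<and> (\<forall>i\<in>D - {L}. g i (x i) = a i) \<and>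
          (\<forall>y\<in>Y. g L y = a L \<and> x(L := y) \<in> A)))"

lemma has_minorI:
  assumes "\<And>i. mono (g i)"
    and "\<And>a. a \<in> D \<rightarrow> {..<k} \<Longrightarrow> \<exists>x Y. card Y = j \<and> (\<forall>i\<in>D - {L}. g i (x i) = a i) \<and>
          (\<forall>y\<in>Y. g L y = a L \<and> x(L := y) \<in> A)"
  shows "has_minor j D L k A"
  using assms unfolding has_minor_def by blast

lemma has_minorE:
  assumes "has_minor j D L k A"
  obtains g where "\<And>i. mono (g i)"
    and "\<And>a. a \<in> D \<rightarrow> {..<k} \<Longrightarrow> \<exists>x Y. card Y = j \<and> (\<forall>i\<in>D - {L}. g i (x i) = a i) \<and>
          (\<forall>y\<in>Y. g L y = a L \<and> x(L := y) \<in> A)"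
  using assms unfolding has_minor_def by blast

text \<open>Two ones on a line whose ranks agree modulo \<open>r\<close> have ranks that differ by a
  positive multiple of \<open>r\<close>, so together with the ones between them they make at least
  \<open>r + 1\<close>. By monotonicity all of these get the same label. Hence each of the
  \<open>r\<close> residue classes avoids the minor with aligned pairs.\<close>

lemma card_avoiding_Suc_minor:
  fixes A :: "('i \<Rightarrow> nat) set"
  assumes "finite D" "L \<in> D" "A \<subseteq> PiE D (\<lambda>_. {..<N})" "0 < r" "\<not> has_minor (Suc r) D L k A"
    and bound: "\<And>B. B \<subseteq> PiE D (\<lambda>_. {..<N}) \<Longrightarrow> \<not> has_minor 2 D L k B \<Longrightarrow> card B \<le> M"
  shows "card A \<le> r * M"
proof -
  define line where "line x y = {z. z < y \<and> x(L := z) \<in> A}" for x :: "'i \<Rightarrow> nat" and y :: nat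
  have fin: "finite (line x y)" for x y by (simp add: line_def)
  define part where "part c = {x \<in> A. card (line x (x L)) mod r = c}" for c
  have line_upd: "line (x(L := z)) y = line x y" for x y z by (simp add: line_def)
  have finA: "finite A" using assms(1,3) by (meson finite_PiE finite_lessThan finite_subset)
  have "card (part c) \<le> M" for c
  proof (rule bound)
    show "part c \<subseteq> PiE D (\<lambda>_. {..<N})" using assms(3) by (auto simp: part_def)
    show "\<not> has_minor 2 D L k (part c)"
    proof
      assume "has_minor 2 D L k (part c)"
      then obtain g where mono: "\<And>i. mono (g i)" and g: "\<And>a. a \<in> D \<rightarrow> {..<k} \<Longrightarrow>
          \<exists>x Y. card Y = 2 \<and> (\<forall>i\<in>D - {L}. g i (x i) = a i) \<and>
          (\<forall>y\<in>Y. g L y = a L \<and> x(L := y) \<in> part c)" by (rule has_minorE) blast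
      have "has_minor (Suc r) D L k A"
      proof (rule has_minorI[OF mono])
        fix a assume "a \<in> D \<rightarrow> {..<k}"
        from g[OF this] obtain x Y where Y: "card Y = 2" and x: "\<forall>i\<in>D - {L}. g i (x i) = a i"
          and gY: "\<And>y. y \<in> Y \<Longrightarrow> g L y = a L \<and> x(L := y) \<in> part c" by blast
        obtain y1 y2 where y: "y1 \<in> Y" "y2 \<in> Y" "y1 < y2"
          using Y by (metis card_2_iff insertCI linorder_neqE_nat)
        \<comment> \<open>The set contains \<open>y1\<close> but not \<open>y2\<close>, so its size
          is exactly the difference of the two ranks; inserting \<open>y2\<close> later gives the
          missing element.\<close>
        let ?S = "{z. y1 \<le> z \<and> z < y2 \<and> x(L := z) \<in> A}"
        have un: "line x y2 = line x y1 \<union> ?S" using y(3) by (auto simp: line_def)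
        have "card (line x y2) = card (line x y1) + card ?S"
          unfolding un by (rule card_Un_disjoint) (auto simp: line_def)
        moreover have "card (line x y1) mod r = card (line x y2) mod r"
          using gY[OF y(1)] gY[OF y(2)] by (auto simp: part_def line_upd)
        ultimately have "r dvd card ?S"
          by (metis add_diff_cancel_left' le_add1 mod_eq_dvd_iff_nat)
        moreover have "?S \<noteq> {}" using gY[OF y(1)] y(3) by (auto simp: part_def)
        then have "card ?S > 0" by (subst card_gt_0_iff) auto
        ultimately have "r \<le> card ?S" by (simp add: dvd_imp_le)
        then have "Suc r \<le> card (insert y2 ?S)" by simp
        then obtain Z where Z: "Z \<subseteq> insert y2 ?S" "card Z = Suc r"
          by (meson obtain_subset_with_card_n)
        have "g L z = a L \<and> x(L := z) \<in> A" if "z \<in> Z" for z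
        proof -
          have z: "y1 \<le> z" "z \<le> y2" "x(L := z) \<in> A"
            using that Z(1) y gY[OF y(2)] by (auto simp: part_def)
          have "g L y1 \<le> g L z" "g L z \<le> g L y2" using mono z by (auto dest: monoD)
          then show ?thesis using gY[OF y(1)] gY[OF y(2)] z(3) by simp
        qed
        with x Z(2) show "\<exists>x Y. card Y = Suc r \<and> (\<forall>i\<in>D - {L}. g i (x i) = a i) \<and>
          (\<forall>y\<in>Y. g L y = a L \<and> x(L := y) \<in> A)" by blast
      qed
      with assms(5) show False by simp
    qed
  qed
  moreover have "A = (\<Union>c<r. part c)" using assms(4) by (auto simp: part_def)
  then have "card A \<le> (\<Sum>c<r. card (part c))" by (metis card_UN_le finite_lessThan)
  ultimately show ?thesis
    using sum_bounded_above[of "{..<r}" "\<lambda>c. card (part c)" M] by simp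
qed

section \<open>Counting through fibres and wide cells\<close>

lemma card_le_fibres:
  assumes "finite Q" "finite A" "\<And>x. x \<in> A \<Longrightarrow> f x \<in> Q"
    and "\<And>q. q \<in> W \<Longrightarrow> card {x \<in> A. f x = q} \<le> t"
    and "\<And>q. q \<in> Q - W \<Longrightarrow> card {x \<in> A. f x = q} \<le> s"
    and "W \<subseteq> Q"
  shows "card A \<le> s * card Q + t * card W"
proof -
  have un: "(\<Union>q\<in>Q. {x \<in> A. f x = q}) = A" using assms(3) by auto
  have "card A \<le> (\<Sum>q\<in>Q. card {x \<in> A. f x = q})"
    using card_UN_le[OF assms(1), of "\<lambda>q. {x \<in> A. f x = q}"] unfolding un .
  also have "\<dots> = (\<Sum>q\<in>W. card {x \<in> A. f x = q}) + (\<Sum>q\<in>Q - W. card {x \<in> A. f x = q})"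
    using sum.subset_diff[OF assms(6,1), of "\<lambda>q. card {x \<in> A. f x = q}"] by (simp add: add.commute)
  also have "\<dots> \<le> (\<Sum>q\<in>W. t) + (\<Sum>q\<in>Q - W. s)"
    using assms(4,5) by (intro add_mono sum_mono) auto
  also have "\<dots> \<le> s * card Q + t * card W"
    using card_mono[OF assms(1), of "Q - W"] by (simp add: mult.commute)
  finally show ?thesis .
qed

text \<open>A slab \<open>w l = v\<close> with more than \<open>4 ^ b * M\<close> cells would
  contain more than \<open>M\<close> cells with a common labelling of their sets \<open>T w\<close>.
  Their projection along \<open>l\<close> is then too large to miss \<open>\<Phi>\<close>, against
  the last assumption. The property \<open>\<Phi>\<close> is a parameter because the two kinds of
  contraction need minors with different numbers of aligned ones.\<close>

lemma card_wide:
  fixes W :: "('i \<Rightarrow> nat) set"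
  assumes "finite D" "l \<in> D" "W \<subseteq> PiE D (\<lambda>_. {..<N})"
    and T: "\<And>w. w \<in> W \<Longrightarrow> T w \<subseteq> {w l * 2 ^ b..<w l * 2 ^ b + 2 ^ b}"
      "\<And>w. w \<in> W \<Longrightarrow> 2 ^ m \<le> card (T w)"
    and bound: "\<And>B. B \<subseteq> PiE (D - {l}) (\<lambda>_. {..<N}) \<Longrightarrow> \<not> \<Phi> B \<Longrightarrow> card B \<le> M"
    and no: "\<And>v R g. R \<subseteq> W \<Longrightarrow> \<forall>w\<in>R. w l = v \<Longrightarrow> mono (g :: nat \<Rightarrow> nat) \<Longrightarrow>
      \<forall>w\<in>R. \<forall>a\<le>m. \<exists>x\<in>T w. g x = a \<Longrightarrow> \<not> \<Phi> ((\<lambda>w. restrict w (D - {l})) ` R)"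
  shows "card W \<le> N * (4 ^ b * M)"
proof -
  have finW: "finite W" using assms(1,3) by (meson finite_PiE finite_lessThan finite_subset)
  have "card {w \<in> W. w l = v} \<le> 4 ^ b * M" for v
  proof (rule ccontr)
    assume "\<not> ?thesis"
    then have "4 ^ b * M < card {w \<in> W. w l = v}" by simp
    from common_labelling[OF _ this, of T "v * 2 ^ b" m] T finW
    obtain R g where R: "R \<subseteq> {w \<in> W. w l = v}" "M < card R" and g: "mono (g :: nat \<Rightarrow> nat)"
      "\<forall>w\<in>R. \<forall>a\<le>m. \<exists>x\<in>T w. g x = a" by auto
    let ?f = "\<lambda>w. restrict w (D - {l})"
    have undef: "w i = undefined" if "w \<in> W" "i \<notin> D" for w i
      using that assms(3) by (meson PiE_arb subsetD)
    \<comment> \<open>Points of \<open>R\<close> share the coordinate \<open>v\<close> in direction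
      \<open>l\<close> and are \<open>undefined\<close> outside \<open>D\<close>, so the remaining
      coordinates determine them.\<close>
    have "inj_on ?f R"
    proof (rule inj_onI, rule ext)
      fix w w' i assume w: "w \<in> R" "w' \<in> R" and eq: "?f w = ?f w'"
      show "w i = w' i"
      proof (cases "i \<in> D - {l}")
        case True
        then show ?thesis using fun_cong[OF eq, of i] by simp
      next
        case False
        have "w \<in> W" "w' \<in> W" "w l = v" "w' l = v" using w R(1) by auto
        then show ?thesis using False undef[of w i] undef[of w' i] by (cases "i = l") auto
      qed
    qed
    then have "M < card (?f ` R)" using R(2) by (simp add: card_image)
    moreover have "\<not> \<Phi> (?f ` R)" using R(1) g by (intro no[of R v g]) auto
    moreover have "?f ` R \<subseteq> PiE (D - {l}) (\<lambda>_. {..<N})"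
      using R(1) assms(3) by (auto simp: PiE_iff subset_iff extensional_def split: if_splits)
    ultimately show False using bound[of "?f ` R"] by simp
  qed
  moreover have un: "(\<Union>v<N. {w \<in> W. w l = v}) = W"
    using assms(2,3) by (auto simp: PiE_iff subset_iff)
  have "card W \<le> (\<Sum>v<N. card {w \<in> W. w l = v})"
    using card_UN_le[of "{..<N}" "\<lambda>v. {w \<in> W. w l = v}"] unfolding un by simp
  ultimately show ?thesis
    using sum_bounded_above[of "{..<N}" "\<lambda>v. card {w \<in> W. w l = v}" "4 ^ b * M"] by simp
qed

section \<open>Contracting one direction\<close>

text \<open>A minor of the contraction lifts to \<open>A\<close>: distinct cells on a line have
  preimages with distinct quotients, hence two aligned ones. Narrow cells hold fewer than
  \<open>2 ^ (2 * k)\<close> ones each. Wide cells are few, because a minor of their projection,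
  aligned in another direction \<open>L'\<close>, would extend to one of \<open>A\<close> aligned in
  \<open>L\<close>.\<close>

lemma contract_along:
  fixes A :: "('i \<Rightarrow> nat) set"
  assumes "finite D" "L \<in> D" "L' \<in> D" "L' \<noteq> L"
    and A: "A \<subseteq> PiE D (\<lambda>i. {..<n i})" and n: "\<And>i. i \<in> D \<Longrightarrow> n i \<le> N"
    and "n L div 2 ^ b + 1 \<le> N"
    and avoid: "\<not> has_minor 2 D L k A"
    and bound: "\<And>B. B \<subseteq> PiE (D - {L}) (\<lambda>_. {..<N}) \<Longrightarrow> \<not> has_minor 2 (D - {L}) L' k B \<Longrightarrow> card B \<le> M"
  shows "\<exists>Q \<subseteq> PiE D (\<lambda>i. {..<(n(L := n L div 2 ^ b + 1)) i}). \<not> has_minor 2 D L k Q \<and>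
    card A \<le> 2 ^ (2 * k) * card Q + 2 ^ b * (N * (4 ^ b * M))"
proof -
  define t :: nat where "t = 2 ^ b"
  have t: "t > 0" by (simp add: t_def)
  define f where "f x = x(L := x L div t)" for x :: "'i \<Rightarrow> nat"
  define Q where "Q = f ` A"
  define T where "T w = {y. w(L := y) \<in> A \<and> y div t = w L}" for w
  have finA: "finite A" using assms(1) A by (meson finite_PiE finite_lessThan finite_subset)
  have block: "y div t = v \<Longrightarrow> v * t \<le> y \<and> y < v * t + t" for y v
    using t by (metis div_mult_mod_eq le_add1 mod_less_divisor nat_add_left_cancel_less)
  have T: "T w \<subseteq> {w L * t..<w L * t + t}" for w
  proof
    fix y assume "y \<in> T w"
    then have "y div t = w L" by (simp add: T_def)
    from block[OF this] show "y \<in> {w L * t..<w L * t + t}" by simp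
  qed
  have finT: "finite (T w)" for w by (rule finite_subset[OF T]) simp
  have Q: "Q \<subseteq> PiE D (\<lambda>i. {..<(n(L := n L div t + 1)) i})"
  proof
    fix q assume "q \<in> Q"
    then obtain x where x: "x \<in> A" "q = f x" by (auto simp: Q_def)
    have x': "x \<in> PiE D (\<lambda>i. {..<n i})" using x A by auto
    then have "x L < n L" using assms(2) by (auto simp: PiE_iff)
    then have "x L div t < n L div t + 1" by (simp add: div_le_mono less_Suc_eq_le)
    then show "q \<in> PiE D (\<lambda>i. {..<(n(L := n L div t + 1)) i})"
      using x' x(2) assms(2) by (auto simp: PiE_iff f_def extensional_def)
  qed
  have QN: "Q \<subseteq> PiE D (\<lambda>_. {..<N})"
  proof
    fix q assume "q \<in> Q"
    with Q have "q \<in> PiE D (\<lambda>i. {..<(n(L := n L div t + 1)) i})" by blast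
    then show "q \<in> PiE D (\<lambda>_. {..<N})"
      using n assms(7) unfolding t_def[symmetric]
      by (fastforce simp: PiE_iff split: if_splits intro: less_le_trans)
  qed
  have "\<not> has_minor 2 D L k Q"
  proof
    assume "has_minor 2 D L k Q"
    then obtain g where mono: "\<And>i. mono (g i)" and g: "\<And>a. a \<in> D \<rightarrow> {..<k} \<Longrightarrow>
          \<exists>x Y. card Y = 2 \<and> (\<forall>i\<in>D - {L}. g i (x i) = a i) \<and>
          (\<forall>y\<in>Y. g L y = a L \<and> x(L := y) \<in> Q)" by (rule has_minorE) blast
    have "has_minor 2 D L k A"
    proof (rule has_minorI)
      show "mono ((g(L := \<lambda>y. g L (y div t))) i)" for i
        using mono by (auto simp: mono_def div_le_mono)
      fix a assume "a \<in> D \<rightarrow> {..<k}"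
      from g[OF this] obtain x Y where Y: "card Y = 2" and x: "\<forall>i\<in>D - {L}. g i (x i) = a i"
        and gY: "\<And>y. y \<in> Y \<Longrightarrow> g L y = a L \<and> x(L := y) \<in> Q" by blast
      have "\<exists>z. z div t = y \<and> x(L := z) \<in> A" if "y \<in> Y" for y
      proof -
        from gY[OF that] obtain z where z: "z \<in> A" "x(L := y) = z(L := z L div t)"
          by (auto simp: Q_def f_def)
        have "z L div t = y" using fun_cong[OF z(2), of L] by simp
        moreover have "x(L := z L) = z" using z(2) by (metis fun_upd_triv fun_upd_upd)
        ultimately show ?thesis using z(1) by auto
      qed
      then obtain z where z: "\<And>y. y \<in> Y \<Longrightarrow> z y div t = y \<and> x(L := z y) \<in> A" by metis
      have "inj_on z Y" using z by (metis inj_onI)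
      then have "card (z ` Y) = 2" using Y by (simp add: card_image)
      then show "\<exists>x Y. card Y = 2 \<and> (\<forall>i\<in>D - {L}. (g(L := \<lambda>y. g L (y div t))) i (x i) = a i) \<and>
          (\<forall>y\<in>Y. (g(L := \<lambda>y. g L (y div t))) L y = a L \<and> x(L := y) \<in> A)"
        using x gY z by (intro exI[of _ x] exI[of _ "z ` Y"]) auto
    qed
    with avoid show False by simp
  qed
  moreover
  \<comment> \<open>The exponent is \<open>2 * k\<close> because each of the \<open>k\<close>
    intervals in direction \<open>L\<close> is to receive two labels, one for each of its two
    aligned ones.\<close>
  define W where "W = {w \<in> Q. 2 ^ (2 * k) \<le> card (T w)}"
  have fibre: "card {x \<in> A. f x = q} \<le> card (T q)" for q
  proof (rule card_inj_on_le)
    show "inj_on (\<lambda>x. x L) {x \<in> A. f x = q}"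
    proof (rule inj_onI)
      fix x y assume "x \<in> {x \<in> A. f x = q}" "y \<in> {x \<in> A. f x = q}" and eq: "x L = y L"
      then have "x(L := x L div t) = y(L := x L div t)" by (simp add: f_def)
      then show "x = y" using eq by (metis fun_upd_triv fun_upd_upd)
    qed
    show "(\<lambda>x. x L) ` {x \<in> A. f x = q} \<subseteq> T q" by (auto simp: T_def f_def)
  qed (rule finT)
  have "card A \<le> 2 ^ (2 * k) * card Q + t * card W"
  proof (rule card_le_fibres)
    show "card {x \<in> A. f x = q} \<le> t" if "q \<in> W" for q
      using fibre[of q] card_mono[OF _ T[of q]] by simp
    show "card {x \<in> A. f x = q} \<le> 2 ^ (2 * k)" if "q \<in> Q - W" for q
      using fibre[of q] that by (auto simp: W_def)
  qed (use finA in \<open>auto simp: Q_def W_def\<close>)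
  moreover have "card W \<le> N * (4 ^ b * M)"
  proof (rule card_wide[OF assms(1,2)])
    show "W \<subseteq> PiE D (\<lambda>_. {..<N})" using QN by (auto simp: W_def)
    show "T w \<subseteq> {w L * 2 ^ b..<w L * 2 ^ b + 2 ^ b}" for w using T[of w] by (simp add: t_def)
    show "2 ^ (2 * k) \<le> card (T w)" if "w \<in> W" for w using that by (simp add: W_def)
    show "card B \<le> M" if "B \<subseteq> PiE (D - {L}) (\<lambda>_. {..<N})" "\<not> has_minor 2 (D - {L}) L' k B" for B
      using that by (rule bound)
    fix v R and h :: "nat \<Rightarrow> nat"
    assume R: "R \<subseteq> W" "\<forall>w\<in>R. w L = v" and h: "mono h" "\<forall>w\<in>R. \<forall>a\<le>2 * k. \<exists>x\<in>T w. h x = a"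
    show "\<not> has_minor 2 (D - {L}) L' k ((\<lambda>w. restrict w (D - {L})) ` R)"
    proof
      assume "has_minor 2 (D - {L}) L' k ((\<lambda>w. restrict w (D - {L})) ` R)"
      then obtain g where mono: "\<And>i. mono (g i)" and g: "\<And>a. a \<in> D - {L} \<rightarrow> {..<k} \<Longrightarrow>
          \<exists>x Y. card Y = 2 \<and> (\<forall>i\<in>D - {L} - {L'}. g i (x i) = a i) \<and>
          (\<forall>y\<in>Y. g L' y = a L' \<and> x(L' := y) \<in> (\<lambda>w. restrict w (D - {L})) ` R)"
        by (rule has_minorE) blast
      have "has_minor 2 D L k A"
      proof (rule has_minorI)
        show "mono ((g(L := \<lambda>y. h y div 2)) i)" for i
          using mono h(1) by (auto simp: mono_def div_le_mono)
        fix a assume a: "a \<in> D \<rightarrow> {..<k}"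
        then have "a \<in> D - {L} \<rightarrow> {..<k}" by auto
        from g[OF this] obtain x Y where Y: "card Y = 2"
          and x: "\<forall>i\<in>D - {L} - {L'}. g i (x i) = a i"
          and gY: "\<And>y. y \<in> Y \<Longrightarrow> g L' y = a L' \<and> x(L' := y) \<in> (\<lambda>w. restrict w (D - {L})) ` R"
          by blast
        \<comment> \<open>The pair aligned in direction \<open>L'\<close> serves to supply one cell
          \<open>w\<close>; the two ones aligned in direction \<open>L\<close> are then both found
          in this cell.\<close>
        obtain y where "y \<in> Y" using Y by fastforce
        with gY obtain w where w: "w \<in> R" "x(L' := y) = restrict w (D - {L})" and y: "g L' y = a L'"
          by blast
        have w': "g i (w i) = a i" if "i \<in> D - {L}" for i
        proof (cases "i = L'")
          case True
          then show ?thesis using fun_cong[OF w(2), of i] y that by simp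
        next
          case False
          then have "x i = w i" using fun_cong[OF w(2), of i] that by simp
          moreover have "g i (x i) = a i" using x that False by blast
          ultimately show ?thesis by simp
        qed
        \<comment> \<open>merging the labels \<open>2 v\<close> and \<open>2 v + 1\<close> yields two ones on one line per box\<close>
        have aL: "a L < k" using a assms(2) by auto
        then obtain y1 y2 where y12: "y1 \<in> T w" "h y1 = 2 * a L" "y2 \<in> T w" "h y2 = 2 * a L + 1"
          using h(2) w(1) by (metis Suc_eq_plus1 Suc_leI less_imp_le mult_le_mono2 mult_less_mono2 pos2)
        have "y1 \<noteq> y2" using y12 by auto
        then show "\<exists>x Y. card Y = 2 \<and> (\<forall>i\<in>D - {L}. (g(L := \<lambda>y. h y div 2)) i (x i) = a i) \<and>
          (\<forall>y\<in>Y. (g(L := \<lambda>y. h y div 2)) L y = a L \<and> x(L := y) \<in> A)"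
          using w' y12 by (intro exI[of _ w] exI[of _ "{y1, y2}"]) (auto simp: T_def)
      qed
      with avoid show False by simp
    qed
  qed
  then have "t * card W \<le> t * (N * (4 ^ b * M))" by simp
  ultimately have "card A \<le> 2 ^ (2 * k) * card Q + t * (N * (4 ^ b * M))" by linarith
  then show ?thesis using Q \<open>\<not> has_minor 2 D L k Q\<close> unfolding t_def by blast
qed

section \<open>Greedy pieces and contraction across the aligned direction\<close>

text \<open>
  The ones \<open>B u y\<close> in rows \<open>u\<close> at places \<open>y < N\<close> are cut greedily into pieces \<open>{\<sigma> q..q}\<close>,
  \<open>q \<in> S\<close>, which end as soon as some row has two ones in them; \<open>e\<close> is the start of the
  unfinished last piece. Contraction across the aligned direction records only the ends \<open>q\<close>: two
  recorded ends on a line enclose an aligned pair, although the ones of a piece need not be aligned.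
\<close>

definition greedy :: "('u \<Rightarrow> nat \<Rightarrow> bool) \<Rightarrow> nat \<Rightarrow> nat set \<Rightarrow> (nat \<Rightarrow> nat) \<Rightarrow> nat \<Rightarrow> bool" where
  "greedy B N S \<sigma> e \<longleftrightarrow>
    S \<subseteq> {..<N} \<and>
    (\<forall>q\<in>S. \<exists>u y z. \<sigma> q \<le> y \<and> y < z \<and> z \<le> q \<and> B u y \<and> B u z) \<and>
    (\<forall>p\<in>S. \<forall>q\<in>S. p < q \<longrightarrow> p < \<sigma> q) \<and>
    (\<forall>q\<in>S. \<forall>u y z. \<sigma> q \<le> y \<longrightarrow> y < z \<longrightarrow> z < q \<longrightarrow> B u y \<longrightarrow> B u z \<longrightarrow> False) \<and>
    (\<forall>y<e. \<exists>q\<in>S. \<sigma> q \<le> y \<and> y \<le> q) \<and>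
    (\<forall>u y z. e \<le> y \<longrightarrow> y < z \<longrightarrow> z < N \<longrightarrow> B u y \<longrightarrow> B u z \<longrightarrow> False) \<and>
    S \<subseteq> {..<e} \<and> e \<le> N"

lemma greedyD:
  assumes "greedy B N S \<sigma> e"
  shows "S \<subseteq> {..<N}"
    and "q \<in> S \<Longrightarrow> \<exists>u y z. \<sigma> q \<le> y \<and> y < z \<and> z \<le> q \<and> B u y \<and> B u z"
    and "p \<in> S \<Longrightarrow> q \<in> S \<Longrightarrow> p < q \<Longrightarrow> p < \<sigma> q"
    and "q \<in> S \<Longrightarrow> \<sigma> q \<le> y \<Longrightarrow> y < z \<Longrightarrow> z < q \<Longrightarrow> B u y \<Longrightarrow> B u z \<Longrightarrow> False"
    and "y < e \<Longrightarrow> \<exists>q\<in>S. \<sigma> q \<le> y \<and> y \<le> q"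
    and "e \<le> y \<Longrightarrow> y < z \<Longrightarrow> z < N \<Longrightarrow> B u y \<Longrightarrow> B u z \<Longrightarrow> False"
    and "S \<subseteq> {..<e}" and "e \<le> N"
  using assms unfolding greedy_def by (simp, simp, simp, metis, simp, metis, simp, simp)

text \<open>Scan the places in increasing order and close the current piece at the first place where
  some row receives its second one in it.\<close>

lemma greedy_exists: "\<exists>S \<sigma> e. greedy B N S \<sigma> e"
proof (induction N)
  case 0
  show ?case by (intro exI[of _ "{}"] exI[of _ "\<lambda>_. 0"] exI[of _ 0]) (auto simp: greedy_def)
next
  case (Suc N)
  then obtain S \<sigma> e where g: "greedy B N S \<sigma> e" by blast
  note S = greedyD(1)[OF g] and Se = greedyD(7,8)[OF g]
  show ?case
  proof (cases "\<exists>u y. e \<le> y \<and> y < N \<and> B u y \<and> B u N")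
    case False
    have "\<forall>u y z. e \<le> y \<longrightarrow> y < z \<longrightarrow> z < Suc N \<longrightarrow> B u y \<longrightarrow> B u z \<longrightarrow> False"
      using greedyD(6)[OF g] False by (metis less_SucE)
    moreover have "S \<subseteq> {..<Suc N}" "e \<le> Suc N" using S Se by auto
    ultimately have "greedy B (Suc N) S \<sigma> e" using g unfolding greedy_def by simp
    then show ?thesis by blast
  next
    case True
    \<comment> \<open>The piece closed at \<open>N\<close> is \<open>{e..N}\<close>, so
      \<open>e\<close> becomes the start belonging to the end \<open>N\<close>; the next piece
      starts at \<open>Suc N\<close>.\<close>
    let ?S = "insert N S" and ?\<sigma> = "\<sigma>(N := e)"
    have ne: "q \<noteq> N" if "q \<in> S" for q using that S by auto
    have "\<forall>q\<in>?S. \<exists>u y z. ?\<sigma> q \<le> y \<and> y < z \<and> z \<le> q \<and> B u y \<and> B u z"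
      using True greedyD(2)[OF g] ne by (auto; metis order_refl)
    moreover have "\<forall>p\<in>?S. \<forall>q\<in>?S. p < q \<longrightarrow> p < ?\<sigma> q"
      using greedyD(3)[OF g] Se S by (auto simp: subset_iff)
    moreover have "\<forall>q\<in>?S. \<forall>u y z. ?\<sigma> q \<le> y \<longrightarrow> y < z \<longrightarrow> z < q \<longrightarrow> B u y \<longrightarrow> B u z \<longrightarrow> False"
      using greedyD(4,6)[OF g] ne by (auto split: if_splits)
    moreover have "\<forall>y<Suc N. \<exists>q\<in>?S. ?\<sigma> q \<le> y \<and> y \<le> q"
    proof (intro allI impI)
      fix y assume "y < Suc N"
      show "\<exists>q\<in>?S. ?\<sigma> q \<le> y \<and> y \<le> q"
      proof (cases "y < e")
        case True
        with greedyD(5)[OF g this] ne show ?thesis by fastforce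
      next
        case False
        then show ?thesis using \<open>y < Suc N\<close> by (intro bexI[of _ N]) auto
      qed
    qed
    moreover have "?S \<subseteq> {..<Suc N}" using S by auto
    ultimately have "greedy B (Suc N) ?S ?\<sigma> (Suc N)"
      unfolding greedy_def by (intro conjI) auto
    then show ?thesis by blast
  qed
qed

text \<open>Fix a block of \<open>c\<close>-values and the coordinates other than \<open>c\<close>
  and \<open>L\<close>. The ones then form a planar array with rows indexed by \<open>c\<close> and
  places by \<open>L\<close>, and \<open>Q\<close> has one point for each end of a greedy piece. The
  three summands of the bound come from the narrow cells, the wide cells and the unfinished
  pieces.\<close>

lemma contract_across:
  fixes A :: "('i \<Rightarrow> nat) set"
  assumes "finite D" "L \<in> D" "c \<in> D" "c \<noteq> L"
    and A: "A \<subseteq> PiE D (\<lambda>i. {..<n i})" and n: "\<And>i. i \<in> D \<Longrightarrow> n i \<le> N"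
    and "n c div 2 ^ b + 1 \<le> N"
    and avoid: "\<not> has_minor 2 D L k A"
    and bound: "\<And>B. B \<subseteq> PiE (D - {c}) (\<lambda>_. {..<N}) \<Longrightarrow> \<not> has_minor 2 (D - {c}) L k B \<Longrightarrow> card B \<le> M"
  shows "\<exists>Q \<subseteq> PiE D (\<lambda>i. {..<(n(c := n c div 2 ^ b + 1)) i}). \<not> has_minor 2 D L k Q \<and>
    card A \<le> 2 * 2 ^ k * card Q + 2 * 2 ^ b * (N * (4 ^ b * ((2 ^ b + 1) * M))) + N ^ (card D - 1)"
proof -
  define t :: nat where "t = 2 ^ b"
  have t: "t > 0" by (simp add: t_def)
  \<comment> \<open>The value 0 in direction \<open>L\<close> is a placeholder:
    \<open>base x\<close> is the name of the planar array that contains \<open>x\<close>.\<close>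
  define base where "base x = x(c := x c div t, L := 0)" for x :: "'i \<Rightarrow> nat"
  define point where "point \<beta> u y = (\<beta>(c := u, L := y) :: 'i \<Rightarrow> nat)" for \<beta> u y
  define B where "B \<beta> u y \<longleftrightarrow> u div t = \<beta> c \<and> point \<beta> u y \<in> A" for \<beta> u y
  have point_base: "point (base x) (x c) (x L) = x" for x
    by (auto simp: point_def base_def)
  have B_base: "B (base x) (x c) (x L)" if "x \<in> A" for x
    using that \<open>c \<noteq> L\<close> by (simp add: B_def point_base) (simp add: base_def)
  have block: "y div t = v \<Longrightarrow> v * t \<le> y \<and> y < v * t + t" for y v
    using t by (metis div_mult_mod_eq le_add1 mod_less_divisor nat_add_left_cancel_less)
  have finA: "finite A" using assms(1) A by (meson finite_PiE finite_lessThan finite_subset)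
  have xL: "x L < n L" if "x \<in> A" for x using that A assms(2) by (auto simp: PiE_iff)
  have "\<forall>\<beta>. \<exists>S \<sigma> e. greedy (B \<beta>) (n L) S \<sigma> e" by (intro allI greedy_exists)
  then obtain S \<sigma> e where "\<And>\<beta>. greedy (B \<beta>) (n L) (S \<beta>) (\<sigma> \<beta>) (e \<beta>)"
    unfolding choice_iff by blast
  note S = greedyD(1)[OF this] and pair = greedyD(2)[OF this] and sep = greedyD(3)[OF this]
    and minimal = greedyD(4)[OF this] and cover = greedyD(5)[OF this] and rest = greedyD(6)[OF this]
  define Q where "Q = {w \<in> PiE D (\<lambda>i. {..<(n(c := n c div t + 1)) i}). w L \<in> S (w(L := 0))}"
  have QN: "Q \<subseteq> PiE D (\<lambda>_. {..<N})"
  proof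
    fix q assume "q \<in> Q"
    then have "q \<in> PiE D (\<lambda>i. {..<(n(c := n c div t + 1)) i})" by (simp add: Q_def)
    then show "q \<in> PiE D (\<lambda>_. {..<N})"
      using n assms(7) unfolding t_def[symmetric]
      by (fastforce simp: PiE_iff split: if_splits intro: less_le_trans)
  qed
  have finQ: "finite Q" using assms(1) QN by (meson finite_PiE finite_lessThan finite_subset)

  have "\<not> has_minor 2 D L k Q"
  proof
    assume "has_minor 2 D L k Q"
    then obtain g where mono: "\<And>i. mono (g i)" and g: "\<And>a. a \<in> D \<rightarrow> {..<k} \<Longrightarrow>
          \<exists>x Y. card Y = 2 \<and> (\<forall>i\<in>D - {L}. g i (x i) = a i) \<and>
          (\<forall>y\<in>Y. g L y = a L \<and> x(L := y) \<in> Q)" by (rule has_minorE) blast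
    have "has_minor 2 D L k A"
    proof (rule has_minorI)
      show "mono ((g(c := \<lambda>y. g c (y div t))) i)" for i
        using mono by (auto simp: mono_def div_le_mono)
      fix a assume "a \<in> D \<rightarrow> {..<k}"
      from g[OF this] obtain x Y where Y: "card Y = 2" and x: "\<forall>i\<in>D - {L}. g i (x i) = a i"
        and gY: "\<And>y. y \<in> Y \<Longrightarrow> g L y = a L \<and> x(L := y) \<in> Q" by blast
      obtain p q where pq: "p \<in> Y" "q \<in> Y" "p < q"
        using Y by (metis card_2_iff insertCI linorder_neqE_nat)
      define \<beta> where "\<beta> = x(L := 0)"
      have inS: "y \<in> S \<beta>" if "y \<in> Y" for y using gY[OF that] by (simp add: Q_def \<beta>_def)
      obtain u y z where yz: "\<sigma> \<beta> q \<le> y" "y < z" "z \<le> q" "B \<beta> u y" "B \<beta> u z"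
        using pair[OF inS[OF pq(2)]] by blast
      \<comment> \<open>The whole piece ending at \<open>q\<close> lies between the ends
        \<open>p\<close> and \<open>q\<close>, which carry the same label; so do the two ones of a
        row inside it.\<close>
      have "p < \<sigma> \<beta> q" using sep inS pq by blast
      then have le: "p \<le> y" "y \<le> q" "p \<le> z" using yz by auto
      have "g L p = a L" "g L q = a L" using gY pq by auto
      then have "g L y = a L" "g L z = a L"
        using le yz(3) monoD[OF mono[of L]] by (metis order_antisym)+
      moreover have "x(c := u, L := y) \<in> A" "x(c := u, L := z) \<in> A" "u div t = x c"
        using yz(4,5) \<open>c \<noteq> L\<close> by (auto simp: B_def point_def \<beta>_def fun_upd_twist)
      moreover have "g c (x c) = a c" using x \<open>c \<in> D\<close> \<open>c \<noteq> L\<close> by auto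
      ultimately show "\<exists>x Y. card Y = 2 \<and> (\<forall>i\<in>D - {L}. (g(c := \<lambda>y. g c (y div t))) i (x i) = a i) \<and>
          (\<forall>y\<in>Y. (g(c := \<lambda>y. g c (y div t))) L y = a L \<and> x(L := y) \<in> A)"
        using x yz(2) \<open>c \<noteq> L\<close> by (intro exI[of _ "x(c := u)"] exI[of _ "{y, z}"]) auto
    qed
    with avoid show False by simp
  qed
  moreover

  \<comment> \<open>the ones in unfinished pieces, at most one per line\<close>
  define A1 where "A1 = {x \<in> A. e (base x) \<le> x L}"
  define A2 where "A2 = A - A1"
  have "card A1 \<le> N ^ (card D - 1)"
  proof -
    have "card A1 \<le> card (PiE (D - {L}) (\<lambda>_. {..<N}))"
    proof (rule card_inj_on_le)
      show "inj_on (\<lambda>x. restrict x (D - {L})) A1"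
      proof (rule inj_onI)
        fix x y assume x: "x \<in> A1" and y: "y \<in> A1" and eq: "restrict x (D - {L}) = restrict y (D - {L})"
        have xA: "x \<in> A" "y \<in> A" using x y by (auto simp: A1_def)
        have other: "x i = y i" if "i \<noteq> L" for i
        proof (cases "i \<in> D")
          case True
          then show ?thesis using fun_cong[OF eq, of i] that by simp
        next
          case False
          then show ?thesis using A xA by (metis PiE_arb subsetD)
        qed
        have base: "base x = base y" using other \<open>c \<noteq> L\<close> by (auto simp: base_def)
        \<comment> \<open>Equal \<open>base\<close> and equal \<open>c\<close>-coordinate put both
          ones into one row, and a row has at most one one in the unfinished piece.\<close>
        have "\<not> x L < y L"
          using rest[of "base x" "x L" "y L" "x c"] x xL[OF xA(2)] B_base[OF xA(1)] B_base[OF xA(2)]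
            base other[OF \<open>c \<noteq> L\<close>] by (auto simp: A1_def)
        moreover have "\<not> y L < x L"
          using rest[of "base x" "y L" "x L" "x c"] y xL[OF xA(1)] B_base[OF xA(1)] B_base[OF xA(2)]
            base other[OF \<open>c \<noteq> L\<close>] by (auto simp: A1_def)
        ultimately have "x L = y L" by simp
        then show "x = y" using other by (intro ext) metis
      qed
      show "(\<lambda>x. restrict x (D - {L})) ` A1 \<subseteq> PiE (D - {L}) (\<lambda>_. {..<N})"
        using A n by (fastforce simp: A1_def PiE_iff intro: less_le_trans)
      show "finite (PiE (D - {L}) (\<lambda>_. {..<N}))" using assms(1) by (intro finite_PiE) auto
    qed
    also have "\<dots> = N ^ (card D - 1)" using assms(1,2) by (simp add: card_PiE)
    finally show ?thesis .
  qed
  moreover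
  have "\<forall>x\<in>A2. \<exists>q\<in>S (base x). \<sigma> (base x) q \<le> x L \<and> x L \<le> q"
  proof
    fix x assume "x \<in> A2"
    then have "x L < e (base x)" by (auto simp: A1_def A2_def)
    then show "\<exists>q\<in>S (base x). \<sigma> (base x) q \<le> x L \<and> x L \<le> q" by (rule cover)
  qed
  \<comment> \<open>\<open>mark x\<close> is the end of a finished piece containing
    \<open>x L\<close>; it replaces the \<open>L\<close>-coordinate under the contraction
    \<open>f\<close>.\<close>
  then obtain mark where mark: "\<And>x. x \<in> A2 \<Longrightarrow> mark x \<in> S (base x)"
    "\<And>x. x \<in> A2 \<Longrightarrow> \<sigma> (base x) (mark x) \<le> x L" "\<And>x. x \<in> A2 \<Longrightarrow> x L \<le> mark x" by metis
  define f where "f x = (base x)(L := mark x)" for x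
  define F where "F w = {x \<in> A2. f x = w}" for w
  define T where "T w = (\<lambda>x. x c) ` F w" for w
  have F_base: "base x = w(L := 0)" "mark x = w L" if "x \<in> F w" for x w
    using that by (auto simp: F_def f_def base_def)
  have fQ: "f x \<in> Q" if "x \<in> A2" for x
  proof -
    have x: "x \<in> PiE D (\<lambda>i. {..<n i})" using that A by (auto simp: A2_def)
    then have "x c < n c" using assms(3) by (auto simp: PiE_iff)
    then have "x c div t < n c div t + 1" by (simp add: div_le_mono less_Suc_eq_le)
    moreover have "mark x < n L" using mark(1)[OF that] S by auto
    ultimately have "f x \<in> PiE D (\<lambda>i. {..<(n(c := n c div t + 1)) i})"
      using x assms(2-4) by (auto simp: PiE_iff f_def base_def extensional_def)
    moreover have "(f x)(L := 0) = base x" "f x L = mark x" by (auto simp: f_def base_def)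
    ultimately show ?thesis using mark(1)[OF that] by (simp add: Q_def)
  qed
  have T: "T w \<subseteq> {w c * t..<w c * t + t}" for w
  proof
    fix u assume "u \<in> T w"
    then obtain x where x: "x \<in> F w" "u = x c" by (auto simp: T_def)
    have "u div t = w c"
      using fun_cong[OF F_base(1)[OF x(1)], of c] x(2) \<open>c \<noteq> L\<close> by (simp add: base_def)
    from block[OF this] show "u \<in> {w c * t..<w c * t + t}" by simp
  qed
  have finT: "finite (T w)" for w by (rule finite_subset[OF T]) simp
  have fibre: "card (F w) \<le> card (T w) * 2" for w
  proof -
    have "card (F w) \<le> card (T w \<times> (UNIV :: bool set))"
    proof (rule card_inj_on_le)
      \<comment> \<open>Before its end a piece has at most one one per row, since it was closed as
        early as possible. A row may have another one at the end itself, and the Boolean separates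
        the two.\<close>
      show "inj_on (\<lambda>x. (x c, x L = w L)) (F w)"
      proof (rule inj_onI)
        fix x y assume x: "x \<in> F w" and y: "y \<in> F w" and eq: "(x c, x L = w L) = (y c, y L = w L)"
        have x2: "x \<in> A2" "y \<in> A2" and xA: "x \<in> A" "y \<in> A" using x y by (auto simp: F_def A2_def)
        have base: "base x = base y" using F_base x y by simp
        have m: "mark x = w L" "mark y = w L" using F_base x y by auto
        have "\<not> (x L < y L \<and> y L < w L)"
          using minimal[OF mark(1)[OF x2(1)] mark(2)[OF x2(1)], of "y L" "x c"]
            B_base[OF xA(1)] B_base[OF xA(2)] eq base m by auto
        moreover have "\<not> (y L < x L \<and> x L < w L)"
          using minimal[OF mark(1)[OF x2(2)] mark(2)[OF x2(2)], of "x L" "y c"]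
            B_base[OF xA(1)] B_base[OF xA(2)] eq base m by auto
        ultimately have "x L = y L" using mark(3)[OF x2(1)] mark(3)[OF x2(2)] m eq
          by (metis Pair_inject le_neq_implies_less linorder_neqE_nat)
        moreover have "x c = y c" using eq by simp
        ultimately have "point (base x) (x c) (x L) = point (base y) (y c) (y L)"
          using base by (simp only:)
        then show "x = y" by (simp only: point_base)
      qed
    qed (use finT in \<open>auto simp: T_def\<close>)
    then show ?thesis by (simp add: card_cartesian_product)
  qed
  \<comment> \<open>Here one label per interval suffices, hence the exponent \<open>k\<close>: an
    aligned pair will come from two different pieces instead of from one cell.\<close>
  define W where "W = {w \<in> Q. 2 ^ k \<le> card (T w)}"
  have "card A2 \<le> 2 * 2 ^ k * card Q + 2 * t * card W"
  proof (rule card_le_fibres[where f = f])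
    show "card {x \<in> A2. f x = q} \<le> 2 * t" if "q \<in> W" for q
      using fibre[of q] card_mono[OF _ T[of q]] by (simp add: F_def)
    show "card {x \<in> A2. f x = q} \<le> 2 * 2 ^ k" if "q \<in> Q - W" for q
      using fibre[of q] that by (auto simp: W_def F_def)
  qed (use finA finQ fQ in \<open>auto simp: W_def A2_def\<close>)
  \<comment> \<open>The minor asks for \<open>t + 2\<close> aligned ends: one is set aside, and the
    other \<open>t + 1\<close> pick rows from a block of only \<open>t\<close>, so two of them pick
    the same row. The price is the factor \<open>t + 1\<close>.\<close>
  moreover have "card W \<le> N * (4 ^ b * ((t + 1) * M))"
  proof (rule card_wide[OF assms(1,3), where \<Phi> = "has_minor (Suc (t + 1)) (D - {c}) L k"])
    show "W \<subseteq> PiE D (\<lambda>_. {..<N})" using QN by (auto simp: W_def)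
    show "T w \<subseteq> {w c * 2 ^ b..<w c * 2 ^ b + 2 ^ b}" for w using T[of w] by (simp add: t_def)
    show "2 ^ k \<le> card (T w)" if "w \<in> W" for w using that by (simp add: W_def)
    show "card B \<le> (t + 1) * M"
      if "B \<subseteq> PiE (D - {c}) (\<lambda>_. {..<N})" "\<not> has_minor (Suc (t + 1)) (D - {c}) L k B" for B
      by (rule card_avoiding_Suc_minor[OF _ _ that(1) _ that(2) bound]) (use assms in auto)
    fix v R and h :: "nat \<Rightarrow> nat"
    assume R: "R \<subseteq> W" "\<forall>w\<in>R. w c = v" and h: "mono h" "\<forall>w\<in>R. \<forall>a\<le>k. \<exists>x\<in>T w. h x = a"
    show "\<not> has_minor (Suc (t + 1)) (D - {c}) L k ((\<lambda>w. restrict w (D - {c})) ` R)"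
    proof
      assume "has_minor (Suc (t + 1)) (D - {c}) L k ((\<lambda>w. restrict w (D - {c})) ` R)"
      then obtain g where mono: "\<And>i. mono (g i)" and g: "\<And>a. a \<in> D - {c} \<rightarrow> {..<k} \<Longrightarrow>
          \<exists>x Y. card Y = Suc (t + 1) \<and> (\<forall>i\<in>D - {c} - {L}. g i (x i) = a i) \<and>
          (\<forall>y\<in>Y. g L y = a L \<and> x(L := y) \<in> (\<lambda>w. restrict w (D - {c})) ` R)"
        by (rule has_minorE) blast
      have "has_minor 2 D L k A"
      proof (rule has_minorI)
        show "mono ((g(c := h)) i)" for i using mono h(1) by auto
        fix a assume a: "a \<in> D \<rightarrow> {..<k}"
        then have "a \<in> D - {c} \<rightarrow> {..<k}" by auto
        from g[OF this] obtain x Y where Y: "card Y = Suc (t + 1)"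
          and x: "\<forall>i\<in>D - {c} - {L}. g i (x i) = a i"
          and gY: "\<And>y. y \<in> Y \<Longrightarrow> g L y = a L \<and> x(L := y) \<in> (\<lambda>w. restrict w (D - {c})) ` R"
          by blast
        define \<beta> where "\<beta> = x(c := v, L := 0)"
        have inR: "\<beta>(L := y) \<in> R" if "y \<in> Y" for y
        proof -
          from gY[OF that] obtain w where w: "w \<in> R" "x(L := y) = restrict w (D - {c})" by blast
          have "w i = (\<beta>(L := y)) i" for i
          proof (cases "i = c")
            case True
            then show ?thesis using R(2) w(1) \<open>c \<noteq> L\<close> by (simp add: \<beta>_def)
          next
            case False
            have "w \<in> PiE D (\<lambda>_. {..<N})" using w(1) R(1) QN by (auto simp: W_def)
            then have "w i = restrict w (D - {c}) i" using False by (auto simp: PiE_iff extensional_def)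
            also have "\<dots> = (x(L := y)) i" using w(2) by simp
            finally show ?thesis using False by (simp add: \<beta>_def)
          qed
          then have "w = \<beta>(L := y)" by (rule ext)
          with w(1) show ?thesis by simp
        qed
        have inS: "y \<in> S \<beta>" if "y \<in> Y" for y
          using inR[OF that] R(1) by (auto simp: W_def Q_def \<beta>_def)
        have ac: "a c \<le> k" using a \<open>c \<in> D\<close> by (auto simp: Pi_iff less_imp_le)
        have "\<exists>u z. h u = a c \<and> u div t = v \<and> point \<beta> u z \<in> A \<and> \<sigma> \<beta> y \<le> z \<and> z \<le> y"
          if "y \<in> Y" for y
        proof -
          obtain u where u: "u \<in> T (\<beta>(L := y))" "h u = a c" using h(2) inR[OF \<open>y \<in> Y\<close>] ac by blast
          then obtain z where z: "z \<in> F (\<beta>(L := y))" "u = z c" by (auto simp: T_def)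
          have b: "base z = \<beta>" using F_base(1)[OF z(1)] by (simp add: \<beta>_def)
          have m: "mark z = y" using F_base(2)[OF z(1)] by simp
          have z2: "z \<in> A2" using z(1) by (simp add: F_def)
          have "u div t = v" using fun_cong[OF b, of c] z(2) \<open>c \<noteq> L\<close> by (simp add: base_def \<beta>_def)
          moreover have "point \<beta> u (z L) \<in> A" using point_base[of z] b z(2) z2 by (simp add: A2_def)
          ultimately show ?thesis using mark(2,3)[OF z2] b m u(2) by auto
        qed
        then obtain u z where u: "\<And>y. y \<in> Y \<Longrightarrow> h (u y) = a c" "\<And>y. y \<in> Y \<Longrightarrow> u y div t = v"
          and z: "\<And>y. y \<in> Y \<Longrightarrow> point \<beta> (u y) (z y) \<in> A" "\<And>y. y \<in> Y \<Longrightarrow> \<sigma> \<beta> y \<le> z y"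
            "\<And>y. y \<in> Y \<Longrightarrow> z y \<le> y" by metis
        have finY: "finite Y" "Y \<noteq> {}" using Y by (auto intro: card_ge_0_finite)
        \<comment> \<open>the piece of the first end may stick out of the box, so only the others are used\<close>
        define p where "p = Min Y"
        have p: "p \<in> Y" "\<And>y. y \<in> Y - {p} \<Longrightarrow> p < y"
          using finY by (auto simp: p_def) (metis Min_le le_neq_implies_less)
        have zge: "p < \<sigma> \<beta> y" if "y \<in> Y - {p}" for y
          using sep[OF inS inS p(2)] p(1) that by blast
        have "\<not> inj_on u (Y - {p})"
        proof
          assume "inj_on u (Y - {p})"
          moreover have "u ` (Y - {p}) \<subseteq> {v * t..<v * t + t}" using block u(2) by fastforce
          ultimately have "card (Y - {p}) \<le> t"
            using card_inj_on_le[of u "Y - {p}" "{v * t..<v * t + t}"] by simp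
          then show False using Y p(1) finY by simp
        qed
        then obtain y1 y2 where y12: "y1 \<in> Y - {p}" "y2 \<in> Y - {p}" "u y1 = u y2" "y1 < y2"
          unfolding inj_on_def by (metis linorder_neqE_nat)
        have "z y1 \<le> y1" "y1 < \<sigma> \<beta> y2" "\<sigma> \<beta> y2 \<le> z y2"
          using z y12 sep[OF inS inS y12(4)] by auto
        then have zlt: "z y1 < z y2" by simp
        \<comment> \<open>The chosen one of the piece ending at \<open>y\<close> lies between the
          ends \<open>p\<close> and \<open>y\<close>, both labelled \<open>a L\<close>.\<close>
        have gz: "g L (z y) = a L" if "y \<in> Y - {p}" for y
        proof -
          have "p \<le> z y" "z y \<le> y" using zge[OF that] z(2)[of y] z(3)[of y] that by auto
          then have "g L p \<le> g L (z y)" "g L (z y) \<le> g L y" using monoD[OF mono] by auto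
          moreover have "g L p = a L" "g L y = a L" using gY p(1) that by auto
          ultimately show ?thesis by simp
        qed
        let ?x = "\<beta>(c := u y1)"
        have "g i (x i) = a i" if "i \<in> D - {L}" "i \<noteq> c" for i using x that by blast
        then have "\<forall>i\<in>D - {L}. (g(c := h)) i (?x i) = a i"
          using u(1) y12(1) by (auto simp: \<beta>_def)
        moreover have "?x(L := z y1) \<in> A" "?x(L := z y2) \<in> A"
          using z(1)[of y1] z(1)[of y2] y12 by (auto simp: point_def)
        ultimately show "\<exists>x Y. card Y = 2 \<and> (\<forall>i\<in>D - {L}. (g(c := h)) i (x i) = a i) \<and>
          (\<forall>y\<in>Y. (g(c := h)) L y = a L \<and> x(L := y) \<in> A)"
          using zlt gz y12(1,2) \<open>c \<noteq> L\<close> by (intro exI[of _ ?x] exI[of _ "{z y1, z y2}"]) auto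
      qed
      with avoid show False by simp
    qed
  qed
  then have "2 * t * card W \<le> 2 * t * (N * (4 ^ b * ((t + 1) * M)))" by simp
  moreover have "card A \<le> card A1 + card A2"
    using card_Un_le[of A1 A2] by (simp add: A2_def A1_def Un_absorb1)
  ultimately have "card A \<le> 2 * 2 ^ k * card Q + 2 * t * (N * (4 ^ b * ((t + 1) * M))) + N ^ (card D - 1)"
    by linarith
  then show ?thesis using \<open>\<not> has_minor 2 D L k Q\<close> unfolding t_def Q_def
    by (intro exI[of _ Q]) (auto simp: Q_def t_def)
qed

section \<open>The recursion\<close>

text \<open>A common form for both contractions, so that they can be iterated in any order: the
  factor is the maximum of \<open>2 ^ (2 * k)\<close> and \<open>2 * 2 ^ k\<close> up to rounding,
  and \<open>M \<ge> 1\<close> lets the term \<open>N ^ Suc m\<close> of the unfinished pieces be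
  absorbed into the error.\<close>

lemma contract:
  fixes A :: "('i \<Rightarrow> nat) set"
  assumes "finite D" "card D = Suc (Suc m)" "L \<in> D" "c \<in> D"
    and A: "A \<subseteq> PiE D (\<lambda>i. {..<n i})" and n: "\<And>i. i \<in> D \<Longrightarrow> n i \<le> N"
    and "n c div 2 ^ b + 1 \<le> N"
    and avoid: "\<not> has_minor 2 D L k A" and "M \<ge> 1"
    and bound: "\<And>c L' B. c \<in> D \<Longrightarrow> L' \<in> D - {c} \<Longrightarrow> B \<subseteq> PiE (D - {c}) (\<lambda>_. {..<N}) \<Longrightarrow>
      \<not> has_minor 2 (D - {c}) L' k B \<Longrightarrow> card B \<le> M * N ^ m"
  shows "\<exists>Q \<subseteq> PiE D (\<lambda>i. {..<(n(c := n c div 2 ^ b + 1)) i}). \<not> has_minor 2 D L k Q \<and>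
    card A \<le> 2 ^ (2 * k + 1) * card Q + 5 * (2 ^ b) ^ 4 * M * N ^ Suc m"
proof -
  define t :: nat where "t = 2 ^ b"
  have t: "t \<ge> 1" by (simp add: t_def)
  have four: "4 ^ b = t * t" by (simp add: t_def flip: power_mult_distrib)
  have t34: "t ^ 3 \<le> t ^ 4" using t by (intro power_increasing) auto
  show ?thesis
  proof (cases "c = L")
    case True
    have "D - {L} \<noteq> {}" using assms(1-3) by (metis card.empty card_Diff_singleton diff_Suc_1 nat.distinct(1))
    then obtain L' where L': "L' \<in> D" "L' \<noteq> L" by blast
    have "\<exists>Q \<subseteq> PiE D (\<lambda>i. {..<(n(L := n L div 2 ^ b + 1)) i}). \<not> has_minor 2 D L k Q \<and>
      card A \<le> 2 ^ (2 * k) * card Q + 2 ^ b * (N * (4 ^ b * (M * N ^ m)))"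
    proof (rule contract_along[OF assms(1,3) L' A n _ avoid])
      show "n L div 2 ^ b + 1 \<le> N" using assms(7) True by simp
      fix B assume "B \<subseteq> PiE (D - {L}) (\<lambda>_. {..<N})" "\<not> has_minor 2 (D - {L}) L' k B"
      then show "card B \<le> M * N ^ m" by (rule bound[OF assms(3), rotated]) (use L' in simp)
    qed
    then obtain Q where Q: "Q \<subseteq> PiE D (\<lambda>i. {..<(n(L := n L div 2 ^ b + 1)) i})"
      "\<not> has_minor 2 D L k Q"
      "card A \<le> 2 ^ (2 * k) * card Q + 2 ^ b * (N * (4 ^ b * (M * N ^ m)))" by blast
    have "2 ^ b * (N * (4 ^ b * (M * N ^ m))) = t ^ 3 * (M * N ^ Suc m)"
      by (simp add: four t_def[symmetric] power3_eq_cube)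
    also have "\<dots> \<le> 5 * t ^ 4 * (M * N ^ Suc m)"
      by (rule mult_right_mono) (use t34 in auto)
    finally have 1: "2 ^ b * (N * (4 ^ b * (M * N ^ m))) \<le> 5 * t ^ 4 * (M * N ^ Suc m)" .
    have "2 ^ (2 * k) * card Q \<le> 2 ^ (2 * k + 1) * card Q" by simp
    with 1 Q(3) have "card A \<le> 2 ^ (2 * k + 1) * card Q + 5 * t ^ 4 * (M * N ^ Suc m)" by linarith
    then have "card A \<le> 2 ^ (2 * k + 1) * card Q + 5 * t ^ 4 * M * N ^ Suc m"
      by (simp only: mult.assoc)
    with Q(1,2) True show ?thesis unfolding t_def by blast
  next
    case False
    have "\<exists>Q \<subseteq> PiE D (\<lambda>i. {..<(n(c := n c div 2 ^ b + 1)) i}). \<not> has_minor 2 D L k Q \<and>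
      card A \<le> 2 * 2 ^ k * card Q + 2 * 2 ^ b * (N * (4 ^ b * ((2 ^ b + 1) * (M * N ^ m)))) +
        N ^ (card D - 1)"
    proof (rule contract_across[OF assms(1,3,4) False A n assms(7) avoid])
      fix B assume "B \<subseteq> PiE (D - {c}) (\<lambda>_. {..<N})" "\<not> has_minor 2 (D - {c}) L k B"
      then show "card B \<le> M * N ^ m"
        by (rule bound[OF assms(4), rotated]) (use assms(3) False in simp)
    qed
    then obtain Q where Q: "Q \<subseteq> PiE D (\<lambda>i. {..<(n(c := n c div 2 ^ b + 1)) i})"
      "\<not> has_minor 2 D L k Q"
      "card A \<le> 2 * 2 ^ k * card Q + 2 * 2 ^ b * (N * (4 ^ b * ((2 ^ b + 1) * (M * N ^ m)))) +
        N ^ (card D - 1)" by blast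
    have "2 * 2 ^ b * (N * (4 ^ b * ((2 ^ b + 1) * (M * N ^ m)))) = 2 * t ^ 3 * (t + 1) * (M * N ^ Suc m)"
      by (simp add: four t_def[symmetric] power3_eq_cube algebra_simps)
    also have "\<dots> \<le> 4 * t ^ 4 * (M * N ^ Suc m)"
    proof (rule mult_right_mono)
      have "2 * t ^ 3 * (t + 1) = 2 * t ^ 4 + 2 * t ^ 3" by (simp add: algebra_simps eval_nat_numeral)
      then show "2 * t ^ 3 * (t + 1) \<le> 4 * t ^ 4" using t34 by simp
    qed simp
    finally have 1: "2 * 2 ^ b * (N * (4 ^ b * ((2 ^ b + 1) * (M * N ^ m)))) \<le> 4 * t ^ 4 * (M * N ^ Suc m)" .
    have "1 * N ^ Suc m \<le> (t ^ 4 * M) * N ^ Suc m"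
      using t assms(9) by (intro mult_right_mono) auto
    then have 2: "N ^ Suc m \<le> t ^ 4 * (M * N ^ Suc m)" by (simp only: mult.assoc mult_1)
    have "(2::nat) * 2 ^ k * card Q \<le> 2 ^ (2 * k + 1) * card Q"
      by (intro mult_right_mono) (auto intro: power_increasing)
    moreover have "card D - 1 = Suc m" using assms(2) by simp
    ultimately have "card A \<le> 2 ^ (2 * k + 1) * card Q + 5 * (t ^ 4 * (M * N ^ Suc m))"
      using Q(3) 1 2 by (simp only: mult.assoc)
    then have "card A \<le> 2 ^ (2 * k + 1) * card Q + 5 * t ^ 4 * M * N ^ Suc m"
      by (simp only: mult.assoc)
    with Q(1,2) show ?thesis unfolding t_def by blast
  qed
qed

text \<open>Induction over the set \<open>E\<close> of directions already contracted; the other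
  sides still have length \<open>N\<close>. All intermediate boxes lie in the cube of side
  \<open>N\<close>, so each step has the same error \<open>V\<close>, which is enlarged by
  \<open>s\<close> to let the power of \<open>s\<close> factor out.\<close>

lemma contract_all:
  fixes A :: "('i \<Rightarrow> nat) set"
  assumes "finite D" "card D = Suc (Suc m)" "L \<in> D"
    and A: "A \<subseteq> PiE D (\<lambda>_. {..<N})" and n: "N div 2 ^ b + 1 \<le> N"
    and avoid: "\<not> has_minor 2 D L k A" and "M \<ge> 1"
    and bound: "\<And>c L' B. c \<in> D \<Longrightarrow> L' \<in> D - {c} \<Longrightarrow> B \<subseteq> PiE (D - {c}) (\<lambda>_. {..<N}) \<Longrightarrow>
      \<not> has_minor 2 (D - {c}) L' k B \<Longrightarrow> card B \<le> M * N ^ m"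
  shows "\<exists>Q \<subseteq> PiE D (\<lambda>_. {..<N div 2 ^ b + 1}). \<not> has_minor 2 D L k Q \<and>
    card A \<le> (2 ^ (2 * k + 1)) ^ card D * (card Q + card D * (5 * (2 ^ b) ^ 4 * M * N ^ Suc m))"
proof -
  define V where "V = 5 * (2 ^ b) ^ 4 * M * N ^ Suc m"
  define s :: nat where "s = 2 ^ (2 * k + 1)"
  have "\<exists>Q \<subseteq> PiE D (\<lambda>i. {..<if i \<in> E then N div 2 ^ b + 1 else N}). \<not> has_minor 2 D L k Q \<and>
      card A \<le> s ^ card E * (card Q + card E * V)" if "E \<subseteq> D" for E
    using finite_subset[OF that assms(1)] that
  proof (induction E rule: finite_induct)
    case empty
    show ?case using A avoid by (intro exI[of _ A]) auto
  next
    case (insert c E)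
    define n' where "n' i = (if i \<in> E then N div 2 ^ b + 1 else N)" for i
    from insert obtain Q where Q: "Q \<subseteq> PiE D (\<lambda>i. {..<n' i})" "\<not> has_minor 2 D L k Q"
      "card A \<le> s ^ card E * (card Q + card E * V)" unfolding n'_def by auto
    have c: "c \<in> D" "n' c = N" using insert by (auto simp: n'_def)
    have upd: "n'(c := n' c div 2 ^ b + 1) = (\<lambda>i. if i \<in> insert c E then N div 2 ^ b + 1 else N)"
      using insert by (auto simp: n'_def)
    have "\<exists>Q' \<subseteq> PiE D (\<lambda>i. {..<(n'(c := n' c div 2 ^ b + 1)) i}). \<not> has_minor 2 D L k Q' \<and>
      card Q \<le> 2 ^ (2 * k + 1) * card Q' + 5 * (2 ^ b) ^ 4 * M * N ^ Suc m"
      by (rule contract[OF assms(1-3) c(1) Q(1) _ _ Q(2) assms(7) bound])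
        (use n c in \<open>auto simp: n'_def\<close>)
    then obtain Q' where Q': "Q' \<subseteq> PiE D (\<lambda>i. {..<if i \<in> insert c E then N div 2 ^ b + 1 else N})"
      "\<not> has_minor 2 D L k Q'" "card Q \<le> s * card Q' + V"
      unfolding upd s_def V_def by blast
    have "card Q + card E * V \<le> s * card Q' + Suc (card E) * V" using Q'(3) by simp
    also have "\<dots> \<le> s * card Q' + s * (Suc (card E) * V)" by (simp add: s_def)
    finally have "s ^ card E * (card Q + card E * V) \<le> s ^ card E * (s * card Q' + s * (Suc (card E) * V))"
      by simp
    with Q(3) have "card A \<le> s ^ card E * (s * card Q' + s * (Suc (card E) * V))" by linarith
    also have "\<dots> = s ^ card (insert c E) * (card Q' + card (insert c E) * V)"
      using insert by (simp add: algebra_simps)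
    finally show ?case using Q'(1,2) by blast
  qed
  from this[of D] obtain Q where "Q \<subseteq> PiE D (\<lambda>i. {..<if i \<in> D then N div 2 ^ b + 1 else N})"
    "\<not> has_minor 2 D L k Q" "card A \<le> s ^ card D * (card Q + card D * V)" by blast
  moreover have "PiE D (\<lambda>i. {..<if i \<in> D then N div 2 ^ b + 1 else N}) = PiE D (\<lambda>_. {..<N div 2 ^ b + 1})"
    by (intro PiE_cong) simp
  ultimately show ?thesis unfolding s_def V_def by auto
qed

section \<open>The one-dimensional case and the recursion in the side length\<close>

lemma card_line_bound:
  fixes A :: "('i \<Rightarrow> nat) set"
  assumes "A \<subseteq> PiE {L} (\<lambda>_. {..<N})" "\<not> has_minor 2 {L} L k A"
  shows "card A \<le> 2 ^ (2 * k)"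
proof (rule ccontr)
  assume *: "\<not> ?thesis"
  have inj: "inj_on (\<lambda>x. x L) A"
    by (rule inj_onI) (use assms(1) in \<open>auto intro!: PiE_ext[of _ "{L}" "\<lambda>_. {..<N}"]\<close>)
  have sub: "(\<lambda>x. x L) ` A \<subseteq> {0..<0 + 2 ^ N}"
  proof clarify
    fix x assume "x \<in> A"
    then have "x L < N" using assms(1) by (auto simp: PiE_iff)
    then show "x L \<in> {0..<0 + 2 ^ N}" using less_exp[of N] by (simp add: less_trans)
  qed
  have "2 ^ (2 * k) \<le> card ((\<lambda>x. x L) ` A)" using * inj by (simp add: card_image)
  \<comment> \<open>The labelling lemma for a single row, with \<open>M = 0\<close> and a block of
    length \<open>2 ^ N\<close>, which covers all places below \<open>N\<close>. The labels
    \<open>2 * v\<close> and \<open>2 * v + 1\<close> are merged afterwards.\<close>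
  then have "\<exists>R\<subseteq>{L}. 0 < card R \<and> (\<exists>g :: nat \<Rightarrow> nat. mono g \<and>
    (\<forall>r\<in>R. \<forall>a\<le>2 * k. \<exists>x\<in>(\<lambda>x. x L) ` A. g x = a))"
    by (intro common_labelling[where p = 0 and b = N]) (use sub in auto)
  then obtain R :: "'i set" and g where R: "0 < card R" and g: "mono (g :: nat \<Rightarrow> nat)"
    "\<forall>r\<in>R. \<forall>a\<le>2 * k. \<exists>x\<in>(\<lambda>x. x L) ` A. g x = a"
    by blast
  then have "R \<noteq> {}" by auto
  have lab: "\<exists>x\<in>A. g (x L) = a" if "a \<le> 2 * k" for a using \<open>R \<noteq> {}\<close> g(2) that by blast
  have "has_minor 2 {L} L k A"
  proof (rule has_minorI)
    show "mono (\<lambda>y. g y div 2)" using g(1) by (auto simp: mono_def div_le_mono)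
    fix a assume "a \<in> {L} \<rightarrow> {..<k}"
    then have "2 * a L \<le> 2 * k" "2 * a L + 1 \<le> 2 * k" by auto
    with lab obtain x y where xy: "x \<in> A" "g (x L) = 2 * a L" "y \<in> A" "g (y L) = 2 * a L + 1"
      by metis
    have undef: "z i = undefined" if "z \<in> A" "i \<noteq> L" for z i
      using assms(1) that by (auto simp: PiE_iff extensional_def subset_iff)
    have "x(L := y L) = y" by (rule ext) (simp add: undef[OF xy(1)] undef[OF xy(3)])
    moreover have "x L \<noteq> y L" using xy by auto
    ultimately show "\<exists>x Y. card Y = 2 \<and> (\<forall>i\<in>{L} - {L}. g (x i) div 2 = a i) \<and>
      (\<forall>y\<in>Y. g y div 2 = a L \<and> x(L := y) \<in> A)"
      using xy by (intro exI[of _ x] exI[of _ "{x L, y L}"]) auto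
  qed
  with assms(2) show False by simp
qed

text \<open>Strong induction on \<open>N\<close>. Contracting all directions by \<open>t\<close>
  costs the factor \<open>G\<close>, while the bound for side about \<open>N / t\<close> is smaller
  by about \<open>t ^ Suc m\<close>; \<open>t\<close> is chosen so that this gain wins.\<close>

lemma card_avoiding_bound_step:
  fixes A :: "('i \<Rightarrow> nat) set"
  assumes "finite D" "card D = Suc (Suc m)" "L \<in> D"
    and "A \<subseteq> PiE D (\<lambda>_. {..<N})" "\<not> has_minor 2 D L k A" "M \<ge> 1"
    and bound: "\<And>c L' N B. c \<in> D \<Longrightarrow> L' \<in> D - {c} \<Longrightarrow> B \<subseteq> PiE (D - {c}) (\<lambda>_. {..<N}) \<Longrightarrow>
      \<not> has_minor 2 (D - {c}) L' k B \<Longrightarrow> card B \<le> M * N ^ m"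
  shows "card A \<le> 2 * (2 ^ (2 * k + 1)) ^ card D * card D * (5 * (2 ^ (4 * k + 4)) ^ 4 * M) * N ^ Suc m"
proof -
  \<comment> \<open>Chosen for \<open>GT\<close>: the exponent \<open>(2 * k + 2) * (m + 2)\<close>
    on its left is at most \<open>(4 * k + 4) * (m + 1)\<close>, because
    \<open>m + 2 \<le> 2 * (m + 1)\<close>.\<close>
  define b where "b = 4 * k + 4"
  define t :: nat where "t = 2 ^ b"
  define G :: nat where "G = (2 ^ (2 * k + 1)) ^ card D"
  define V where "V = 5 * t ^ 4 * M"
  \<comment> \<open>The factor 2 makes the accumulated error half of the claimed bound, leaving the
    other half for the contracted set.\<close>
  define K where "K = 2 * G * card D * V"
  have G: "G \<ge> 1" by (simp add: G_def)
  have "2 ^ 4 \<le> t" unfolding t_def b_def by (intro power_increasing) auto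
  then have t: "t \<ge> 16" by simp
  have GT: "2 ^ Suc (Suc m) * G \<le> t ^ Suc m"
  proof -
    have "2 ^ Suc (Suc m) * G = (2::nat) ^ (Suc (Suc m) + (2 * k + 1) * Suc (Suc m))"
      by (simp only: G_def assms(2) power_add power_mult)
    also have "\<dots> \<le> 2 ^ (b * Suc m)"
      by (intro power_increasing) (auto simp: b_def algebra_simps)
    finally show ?thesis by (simp only: t_def power_mult)
  qed
  \<comment> \<open>This settles \<open>N < t\<close>, where the whole cube has only
    \<open>N * N ^ Suc m\<close> points.\<close>
  have "t \<le> K"
  proof -
    have "t * 1 \<le> t ^ 4 * M" using assms(6) t by (intro mult_mono self_le_power) auto
    then have "t \<le> V" by (simp add: V_def)
    moreover have "1 * V \<le> 2 * G * card D * V" using G assms(2) by (intro mult_right_mono) auto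
    ultimately show ?thesis unfolding K_def by linarith
  qed
  have "card A \<le> K * N ^ Suc m" using assms(4,5)
  proof (induction N arbitrary: A rule: less_induct)
    case (less N)
    show ?case
    proof (cases "N < t")
      case True
      have "card A \<le> card (PiE D (\<lambda>_. {..<N}))"
        using less.prems(1) assms(1) by (intro card_mono finite_PiE) auto
      also have "\<dots> = N * N ^ Suc m" using assms(1,2) by (simp add: card_PiE)
      also have "\<dots> \<le> K * N ^ Suc m" using True \<open>t \<le> K\<close> by (intro mult_right_mono) auto
      finally show ?thesis .
    next
      case False
      define n where "n = N div t + 1"
      have "N div t \<le> N div 16" using t by (intro div_le_mono2) auto
      then have n: "n < N" using False t by (simp add: n_def)
      have "\<exists>Q \<subseteq> PiE D (\<lambda>_. {..<N div 2 ^ b + 1}). \<not> has_minor 2 D L k Q \<and>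
        card A \<le> (2 ^ (2 * k + 1)) ^ card D * (card Q + card D * (5 * (2 ^ b) ^ 4 * M * N ^ Suc m))"
        by (rule contract_all[OF assms(1-3) less.prems(1) _ less.prems(2) assms(6) bound])
          (use n in \<open>auto simp: n_def t_def\<close>)
      then obtain Q where Q: "Q \<subseteq> PiE D (\<lambda>_. {..<n})" "\<not> has_minor 2 D L k Q"
        "card A \<le> G * (card Q + card D * (V * N ^ Suc m))"
        unfolding n_def t_def G_def V_def by blast
      have "card Q \<le> K * n ^ Suc m" by (rule less.IH[OF n Q(1,2)])
      then have "card A \<le> G * (K * n ^ Suc m + card D * (V * N ^ Suc m))"
        using Q(3) by (meson add_right_mono le_trans mult_le_mono2)
      then have A: "2 * card A \<le> K * (2 * G * n ^ Suc m) + K * N ^ Suc m"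
        by (simp add: K_def algebra_simps)
      \<comment> \<open>Rounding up adds at most \<open>t \<le> N\<close>. The resulting factor
        \<open>2 ^ Suc m\<close> and the factor 2 in \<open>K\<close> together account for
        \<open>2 ^ Suc (Suc m)\<close> in \<open>GT\<close>.\<close>
      have "n * t \<le> 2 * N" using False div_times_less_eq_dividend[of N t]
        unfolding n_def distrib_right by linarith
      then have "(n * t) ^ Suc m \<le> (2 * N) ^ Suc m" by (intro power_mono) auto
      have "2 ^ Suc m * (2 * G * n ^ Suc m) = n ^ Suc m * (2 ^ Suc (Suc m) * G)"
        by (simp add: ac_simps)
      also have "\<dots> \<le> n ^ Suc m * t ^ Suc m" using GT by (rule mult_le_mono2)
      also have "\<dots> \<le> 2 ^ Suc m * N ^ Suc m"
        using \<open>(n * t) ^ Suc m \<le> (2 * N) ^ Suc m\<close> by (simp only: power_mult_distrib)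
      finally have "2 ^ Suc m * (2 * G * n ^ Suc m) \<le> 2 ^ Suc m * N ^ Suc m" .
      then have "2 * G * n ^ Suc m \<le> N ^ Suc m" by simp
      then have "K * (2 * G * n ^ Suc m) \<le> K * N ^ Suc m" by (rule mult_le_mono2)
      with A show ?thesis by linarith
    qed
  qed
  then show ?thesis by (simp only: K_def G_def V_def t_def b_def)
qed

text \<open>Induction on the dimension. \<open>C\<close> is chosen before the index set
  \<open>D\<close>, so the hypothesis applies to every \<open>D - {c}\<close> and every aligned
  direction in it.\<close>

lemma card_avoiding_bound:
  "\<exists>C. \<forall>k\<ge>1. \<forall>D L N. \<forall>A :: ('i \<Rightarrow> nat) set.
    finite D \<longrightarrow> card D = Suc m \<longrightarrow> L \<in> D \<longrightarrow> A \<subseteq> PiE D (\<lambda>_. {..<N}) \<longrightarrow> \<not> has_minor 2 D L k A \<longrightarrow>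
    card A \<le> 2 ^ (C * k) * N ^ m"
proof (induction m)
  case 0
  have bound: "card A \<le> 2 ^ (2 * k) * N ^ 0"
    if "card D = Suc 0" "L \<in> D" "A \<subseteq> PiE D (\<lambda>_. {..<N})" "\<not> has_minor 2 D L k A"
    for k N D L and A :: "('i \<Rightarrow> nat) set"
  proof -
    have "D = {L}" using that(1,2) by (auto simp: card_Suc_eq)
    then show ?thesis using card_line_bound that(3,4) by auto
  qed
  show ?case by (intro exI[of _ 2] allI impI) (rule bound)
next
  case (Suc m)
  then obtain C where "\<forall>k\<ge>1. \<forall>D L N. \<forall>A :: ('i \<Rightarrow> nat) set.
    finite D \<longrightarrow> card D = Suc m \<longrightarrow> L \<in> D \<longrightarrow> A \<subseteq> PiE D (\<lambda>_. {..<N}) \<longrightarrow> \<not> has_minor 2 D L k A \<longrightarrow>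
    card A \<le> 2 ^ (C * k) * N ^ m" ..
  note C = this[rule_format]
  define d where "d = Suc (Suc m)"
  have bound: "card A \<le> 2 ^ ((C + 4 * d + 36) * k) * N ^ Suc m"
    if "k \<ge> 1" "finite D" "card D = Suc (Suc m)" "L \<in> D" "A \<subseteq> PiE D (\<lambda>_. {..<N})" "\<not> has_minor 2 D L k A"
    for k N D L and A :: "('i \<Rightarrow> nat) set"
  proof -
    have "card A \<le> 2 * (2 ^ (2 * k + 1)) ^ card D * card D * (5 * (2 ^ (4 * k + 4)) ^ 4 * 2 ^ (C * k)) * N ^ Suc m"
    proof (rule card_avoiding_bound_step[OF that(2-6)])
      fix c L' N and B :: "('i \<Rightarrow> nat) set"
      assume "c \<in> D" "L' \<in> D - {c}" "B \<subseteq> PiE (D - {c}) (\<lambda>_. {..<N})" "\<not> has_minor 2 (D - {c}) L' k B"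
      then show "card B \<le> 2 ^ (C * k) * N ^ m" using that(1-3) by (intro C[of k "D - {c}" L']) auto
    qed simp
    also have "\<dots> \<le> 2 ^ ((C + 4 * d + 36) * k) * N ^ Suc m"
    proof (rule mult_right_mono)
      have "d \<le> 2 ^ d" using less_exp[of d] by simp
      then have "2 * (2 ^ (2 * k + 1)) ^ d * d * (5 * (2 ^ (4 * k + 4)) ^ 4 * 2 ^ (C * k)) \<le>
        2 * (2 ^ (2 * k + 1)) ^ d * 2 ^ d * (2 ^ 3 * (2 ^ (4 * k + 4)) ^ 4 * 2 ^ (C * k) :: nat)"
        by (intro mult_mono) auto
      also have "\<dots> = 2 ^ (1 + (2 * k + 1) * d + d + (3 + (4 * k + 4) * 4 + C * k))"
        by (simp only: power_add power_mult power_one_right)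
      also have "\<dots> \<le> 2 ^ ((C + 4 * d + 36) * k)"
      \<comment> \<open>Since \<open>k \<ge> 1\<close>, the constant terms become multiples of
        \<open>k\<close>: \<open>20 + 16 * k \<le> 36 * k\<close> and
        \<open>2 * d + 2 * d * k \<le> 4 * d * k\<close>.\<close>
      proof (rule power_increasing)
        obtain i where "k = Suc i" using \<open>1 \<le> k\<close> by (cases k) auto
        then show "1 + (2 * k + 1) * d + d + (3 + (4 * k + 4) * 4 + C * k) \<le> (C + 4 * d + 36) * k"
          by (simp add: algebra_simps)
      qed simp
      finally show "2 * (2 ^ (2 * k + 1)) ^ card D * card D * (5 * (2 ^ (4 * k + 4)) ^ 4 * 2 ^ (C * k))
        \<le> 2 ^ ((C + 4 * d + 36) * k)" using that(3) by (simp add: d_def)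
    qed simp
    finally show ?thesis .
  qed
  show ?case by (intro exI[of _ "C + 4 * d + 36"] allI impI) (rule bound)
qed

section \<open>From interval minors to tuple permutation matrices\<close>

text \<open>A strictly increasing \<open>e i\<close> is the increasing enumeration of its own image.
  Taking these images as the selected coordinate sets turns the lookup in \<open>submatrix\<close>
  into an application of \<open>e i\<close>.\<close>

lemma containsI:
  assumes "dims A = replicate d n" "dims B = ms" "length ms = d" "ones B \<subseteq> positions ms"
    and mono: "\<And>i v w. i < d \<Longrightarrow> v < w \<Longrightarrow> w < ms ! i \<Longrightarrow> e i v < e i w"
    and less: "\<And>i v. i < d \<Longrightarrow> v < ms ! i \<Longrightarrow> e i v < n"
    and ones: "\<And>b. b \<in> ones B \<Longrightarrow> map (\<lambda>i. e i (b ! i)) [0..<d] \<in> ones A"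
  shows "contains A B"
proof -
  define Ss where "Ss = map (\<lambda>i. e i ` {..<ms ! i}) [0..<d]"
  have inj: "inj_on (e i) {..<ms ! i}" if "i < d" for i
    by (rule linorder_inj_onI) (use mono[OF that] in \<open>force+\<close>)
  have enum: "sorted_list_of_set (e i ` {..<ms ! i}) = map (e i) [0..<ms ! i]" if "i < d" for i
  proof -
    have "sorted_wrt (<) (map (e i) [0..<ms ! i])"
      using mono[OF that] by (auto simp: sorted_wrt_iff_nth_less)
    then have "sorted (map (e i) [0..<ms ! i])" "distinct (map (e i) [0..<ms ! i])"
      by (simp_all add: strict_sorted_iff)
    then have "sorted_list_of_set (set (map (e i) [0..<ms ! i])) = map (e i) [0..<ms ! i]"
      by (rule sorted_list_of_set.idem_if_sorted_distinct)
    then show ?thesis by (simp add: atLeast0LessThan)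
  qed
  have cards: "map card Ss = ms"
    using assms(3) inj by (intro nth_equalityI) (auto simp: Ss_def card_image)
  have "ones B \<subseteq> ones (submatrix A Ss)"
  proof
    fix b assume b: "b \<in> ones B"
    then have pos: "b \<in> positions ms" using assms(4) by auto
    then have len: "length b = d" and lt: "\<And>i. i < d \<Longrightarrow> b ! i < ms ! i"
      using assms(3) by (auto simp: positions_def list_all2_conv_all_nth)
    have "map2 (\<lambda>S x. sorted_list_of_set S ! x) Ss b = map (\<lambda>i. e i (b ! i)) [0..<d]"
      using len lt enum by (intro nth_equalityI) (auto simp: Ss_def)
    with ones[OF b] pos show "b \<in> ones (submatrix A Ss)" by (simp add: submatrix_def cards)
  qed
  moreover have "list_all2 (\<lambda>S n. S \<subseteq> {..<n}) Ss (dims A)"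
    using assms(1) less by (auto simp: list_all2_conv_all_nth Ss_def)
  moreover have "dims (submatrix A Ss) = dims B" using assms(2) by (simp add: submatrix_def cards)
  ultimately show ?thesis unfolding contains_def by blast
qed

text \<open>Each coordinate value of \<open>P'\<close> belongs to exactly one one-entry, so the box
  of this entry can decide which coordinate of \<open>A\<close> represents that value. Labels order
  the choices from different boxes; in direction \<open>l\<close>, the aligned ones of one box
  represent a whole tuple.\<close>

lemma contains_tuple_permutation:
  assumes P': "permutation_matrix d k P'" and "l < d"
    and P: "P = kronecker P' (all_ones ((replicate d 1)[l := j]))"
    and A: "is_matrix (replicate d n) A"
    and minor: "has_minor (Suc j) {..<d} l k {f \<in> PiE {..<d} (\<lambda>_. {..<n}). map f [0..<d] \<in> ones A}"
      (is "has_minor _ _ _ _ ?X")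
  shows "contains A P"
proof -
  obtain g where mono: "\<And>i. mono (g i)" and g: "\<And>a. a \<in> {..<d} \<rightarrow> {..<k} \<Longrightarrow>
      \<exists>x Y. card Y = Suc j \<and> (\<forall>i\<in>{..<d} - {l}. g i (x i) = a i) \<and>
      (\<forall>y\<in>Y. g l y = a l \<and> x(l := y) \<in> ?X)" using minor by (rule has_minorE) blast
  have posP': "length a = d" "\<And>i. i < d \<Longrightarrow> a ! i < k" if "a \<in> ones P'" for a
    using P' that by (auto simp: permutation_matrix_def is_matrix_def positions_def
        list_all2_conv_all_nth subset_iff)
  have "\<forall>a\<in>ones P'. \<exists>x Y. card Y = Suc j \<and> (\<forall>i\<in>{..<d} - {l}. g i (x i) = a ! i) \<and>
      (\<forall>y\<in>Y. g l y = a ! l \<and> x(l := y) \<in> ?X)"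
    using posP' by (intro ballI g) auto
  then obtain x Y where Y: "\<And>a. a \<in> ones P' \<Longrightarrow> card (Y a) = Suc j"
    and x: "\<And>a i. a \<in> ones P' \<Longrightarrow> i < d \<Longrightarrow> i \<noteq> l \<Longrightarrow> g i (x a i) = a ! i"
    and gY: "\<And>a y. a \<in> ones P' \<Longrightarrow> y \<in> Y a \<Longrightarrow> g l y = a ! l"
    and X: "\<And>a y. a \<in> ones P' \<Longrightarrow> y \<in> Y a \<Longrightarrow> (x a)(l := y) \<in> ?X"
    unfolding bchoice_iff by (elim exE) force
  have "\<exists>a. a \<in> ones P' \<and> a ! i = v" if "i < d" "v < k" for i v
    using P' that unfolding permutation_matrix_def cross_section_def by blast
  then obtain p where p: "\<And>i v. i < d \<Longrightarrow> v < k \<Longrightarrow> p i v \<in> ones P' \<and> p i v ! i = v" by metis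
  \<comment> \<open>All directions thus consult the same box for the entry \<open>a\<close>, so
    their separate choices fit together to a point of \<open>?X\<close>.\<close>
  have p_nth: "p i (a ! i) = a" if "a \<in> ones P'" "i < d" for a i
  proof -
    have in_pos: "b \<in> positions (replicate d k)" if "b \<in> ones P'" for b
      using P' that by (auto simp: permutation_matrix_def is_matrix_def)
    have "\<exists>!b. b \<in> cross_section (replicate d k) i (a ! i) \<and> b \<in> ones P'"
      using P' posP'[OF that(1)] that(2) by (auto simp: permutation_matrix_def)
    then show ?thesis using p[OF that(2), of "a ! i"] posP'[OF that(1)] that in_pos
      unfolding cross_section_def by blast
  qed
  define pt where "pt v w = sorted_list_of_set (Y (p l v)) ! w" for v w
  have finY: "finite (Y a)" if "a \<in> ones P'" for a using Y[OF that] by (intro card_ge_0_finite) simp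
  have pt: "pt v w \<in> Y (p l v)" if "v < k" "w \<le> j" for v w
  proof -
    have "pt v w \<in> set (sorted_list_of_set (Y (p l v)))"
      unfolding pt_def using p[OF \<open>l < d\<close> that(1)] Y that(2) by (intro nth_mem) simp
    then show ?thesis using p[OF \<open>l < d\<close> that(1)] finY by simp
  qed
  have pt_mono: "pt v w < pt v w'" if "v < k" "w < w'" "w' \<le> j" for v w w'
    using sorted_wrt_nth_less[OF strict_sorted_list_of_set that(2), of "Y (p l v)"]
      p[OF \<open>l < d\<close> that(1)] Y that(3) by (simp add: pt_def)
  have g_pt: "g l (pt v w) = v" if "v < k" "w \<le> j" for v w
    using gY[OF _ pt[OF that]] p[OF \<open>l < d\<close> that(1)] by simp
  \<comment> \<open>In direction \<open>l\<close> a coordinate \<open>w\<close> of the Kronecker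
    product splits into the block \<open>w div j\<close> and the place \<open>w mod j\<close> within
    the tuple.\<close>
  define e where "e i w = (if i = l then pt (w div j) (w mod j) else x (p i w) i)" for i w
  define js where "js = (replicate d 1)[l := j]"
  have js: "length js = d" "\<And>i. i < d \<Longrightarrow> js ! i = (if i = l then j else 1)"
    by (auto simp: js_def nth_list_update)
  define ms where "ms = map2 (*) (replicate d k) js"
  have ms: "length ms = d" "\<And>i. i < d \<Longrightarrow> ms ! i = (if i = l then k * j else k)"
    using js by (auto simp: ms_def)
  have dimP': "dims P' = replicate d k" using P' by (simp add: permutation_matrix_def is_matrix_def)
  have g_less: "y < z" if "g i y < g i z" for i y z
    using that monoD[OF mono[of i], of z y] by (meson leD not_le_imp_less)
  have div_less: "w div j < k" "w mod j \<le> j" if "w < k * j" for w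
    using that by (auto simp: less_mult_imp_div_less intro: order_trans[OF mod_le_divisor] dest: gr_implies_not0)
  have onesP: "length b = d \<and> (\<exists>a\<in>ones P'. b ! l < a ! l * j + j \<and> a ! l * j \<le> b ! l \<and> (\<forall>i<d. i \<noteq> l \<longrightarrow> b ! i = a ! i))"
    if "b \<in> ones P" for b
  proof -
    obtain a c where a: "a \<in> ones P'" and c: "c \<in> positions js" and b: "b = map2 (+) (map2 (*) a js) c"
      using \<open>b \<in> ones P\<close> by (auto simp: P kronecker_def all_ones_def js_def)
    have len: "length a = d" "length c = d" "\<And>i. i < d \<Longrightarrow> c ! i < js ! i"
      using posP'[OF a] c js by (auto simp: positions_def list_all2_conv_all_nth)
    have bi: "b ! i = a ! i * js ! i + c ! i" if "i < d" for i using len js that by (simp add: b)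
    have "b ! i = a ! i" if "i < d" "i \<noteq> l" for i
      using bi[OF that(1)] len(3)[OF that(1)] js(2)[OF that(1)] that(2) by simp
    moreover have "b ! l < a ! l * j + j" "a ! l * j \<le> b ! l"
      using bi[OF \<open>l < d\<close>] len(3)[OF \<open>l < d\<close>] js(2)[OF \<open>l < d\<close>] by simp_all
    moreover have "length b = d" using len js by (simp add: b)
    ultimately show ?thesis using a by blast
  qed
  show ?thesis
  proof (rule containsI[where d = d and n = n and ms = ms and e = e])
    show "dims A = replicate d n" using A by (simp add: is_matrix_def)
    show "dims P = ms" by (simp add: P kronecker_def all_ones_def ms_def js_def dimP')
    show "length ms = d" by (rule ms)
    show "ones P \<subseteq> positions ms"
    proof
      fix b assume "b \<in> ones P"
      from onesP[OF this] obtain a where a: "length b = d" "a \<in> ones P'" "b ! l < a ! l * j + j"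
        "\<forall>i<d. i \<noteq> l \<longrightarrow> b ! i = a ! i" by blast
      have "Suc (a ! l) * j \<le> k * j" using posP'(2)[OF a(2) \<open>l < d\<close>] by (intro mult_right_mono) auto
      then have "b ! i < ms ! i" if "i < d" for i using a ms(2)[OF that] posP'(2)[OF a(2) that] that by auto
      then show "b \<in> positions ms" using a(1) ms(1) by (auto simp: positions_def list_all2_conv_all_nth)
    qed
    show "e i v < e i w" if "i < d" "v < w" "w < ms ! i" for i v w
    proof (cases "i = l")
      case False
      have "v < k" "w < k" using that ms(2)[OF that(1)] False by auto
      then have "g i (e i v) = v" "g i (e i w) = w" using x p that(1) False by (auto simp: e_def)
      then show ?thesis using g_less[of i] that(2) by simp
    next
      case True
      have w: "w < k * j" "v < k * j" using that ms(2)[OF that(1)] True by auto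
      note dl = div_less[OF w(1)] div_less[OF w(2)]
      show ?thesis
      proof (cases "v div j = w div j")
        case eq: True
        then have "v mod j < w mod j" using that(2)
          by (metis add_less_cancel_left div_mult_mod_eq)
        then show ?thesis using pt_mono dl eq True by (simp add: e_def)
      next
        case False
        then have "v div j < w div j" using that(2) by (simp add: div_le_mono order_less_le)
        then show ?thesis using g_less[of l "e i v" "e i w"] g_pt dl True by (simp add: e_def)
      qed
    qed
    show "e i v < n" if "i < d" "v < ms ! i" for i v
    proof (cases "i = l")
      case False
      have v: "v < k" using that ms(2)[OF that(1)] False by auto
      have a: "p i v \<in> ones P'" using p that(1) v by blast
      have "Y (p i v) \<noteq> {}" using Y[OF a] by force
      then obtain y where "y \<in> Y (p i v)" by blast
      from X[OF a this] have "((x (p i v))(l := y)) i < n" using that(1) by (auto simp: PiE_iff)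
      then show ?thesis using False by (simp add: e_def)
    next
      case True
      then have dl: "v div j < k" "v mod j \<le> j" using that ms(2)[OF that(1)] div_less[of v] by auto
      have "p l (v div j) \<in> ones P'" using p \<open>l < d\<close> dl(1) by blast
      from X[OF this pt[OF dl]] have "((x (p l (v div j)))(l := pt (v div j) (v mod j))) l < n"
        using \<open>l < d\<close> unfolding mem_Collect_eq PiE_iff by blast
      then show ?thesis using True by (simp add: e_def)
    qed
    fix b assume "b \<in> ones P"
    from onesP[OF this] obtain a where a: "length b = d" "a \<in> ones P'" "b ! l < a ! l * j + j"
      "a ! l * j \<le> b ! l" "\<forall>i<d. i \<noteq> l \<longrightarrow> b ! i = a ! i" by blast
    have al: "a ! l < k" using posP'(2)[OF a(2) \<open>l < d\<close>] .
    have bl: "b ! l div j = a ! l" using a(3,4) by (intro div_nat_eqI) (auto simp: mult.commute)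
    have j: "j > 0" using a(3,4) by (cases j) auto
    define y where "y = pt (a ! l) (b ! l mod j)"
    have y: "y \<in> Y a" unfolding y_def using pt[OF al, of "b ! l mod j"] p_nth[OF a(2) \<open>l < d\<close>] j by simp
    have "e i (b ! i) = ((x a)(l := y)) i" if "i < d" for i
      using that a(5) p_nth[OF a(2) that] bl by (auto simp: e_def y_def)
    then have "map (\<lambda>i. e i (b ! i)) [0..<d] = map ((x a)(l := y)) [0..<d]" by simp
    also have "\<dots> \<in> ones A" using X[OF a(2) y] by blast
    finally show "map (\<lambda>i. e i (b ! i)) [0..<d] \<in> ones A" .
  qed
qed

section \<open>Passing to the extremal function and the limit superior\<close>

lemma card_ones_le:
  assumes "is_matrix (replicate d n) A"
  shows "card (ones A) \<le> card {f \<in> PiE {..<d} (\<lambda>_. {..<n}). map f [0..<d] \<in> ones A}" (is "_ \<le> card ?X")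
proof -
  have "a \<in> (\<lambda>f. map f [0..<d]) ` ?X" if "a \<in> ones A" for a
  proof -
    have a: "length a = d" "\<And>i. i < d \<Longrightarrow> a ! i < n"
      using assms that by (auto simp: is_matrix_def positions_def list_all2_conv_all_nth subset_iff)
    have "map (restrict ((!) a) {..<d}) [0..<d] = a" using a(1) by (intro nth_equalityI) auto
    then show ?thesis using a(2) that by (intro image_eqI[of _ _ "restrict ((!) a) {..<d}"]) auto
  qed
  then have "ones A \<subseteq> (\<lambda>f. map f [0..<d]) ` ?X" by blast
  moreover have "finite ?X" by (rule finite_subset[of _ "PiE {..<d} (\<lambda>_. {..<n})"]) (auto intro: finite_PiE)
  ultimately show ?thesis by (meson card_image_le card_mono finite_imageI le_trans)
qed

text \<open>\<open>Max\<close> is meaningful on a finite nonempty set: the bound \<open>m\<close>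
  gives finiteness, and the zero matrix, which avoids any \<open>B\<close> with a one-entry, gives
  nonemptiness.\<close>

lemma extremal_le:
  assumes "ones B \<noteq> {}"
    and "\<And>A. is_matrix (replicate d n) A \<Longrightarrow> avoids A B \<Longrightarrow> card (ones A) \<le> m"
  shows "extremal n B d \<le> m"
proof -
  let ?S = "{card (ones A) | A. is_matrix (replicate d n) A \<and> avoids A B}"
  have "?S \<subseteq> {..m}" using assms(2) by auto
  then have fin: "finite ?S" by (rule finite_subset) simp
  let ?Z = "ZO_Matrix (replicate d n) {}"
  have "is_matrix (replicate d n) ?Z" by (simp add: is_matrix_def)
  moreover have "avoids ?Z B" using assms(1) by (auto simp: contains_def submatrix_def)
  ultimately have "card (ones ?Z) \<in> ?S" by blast
  then have "?S \<noteq> {}" by blast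
  with fin show ?thesis unfolding extremal_def using assms(2) by (subst Max_le_iff) auto
qed

theorem theorem4p1:
  fixes d j :: nat
  assumes "d \<ge> 1" and "j \<ge> 1"
  shows "\<exists>C::real. C > 0 \<and>
    (\<forall>k\<ge>1. \<forall>P' P.
       permutation_matrix d k P' \<longrightarrow> tuple_permutation_matrix d j P' P \<longrightarrow>
       S_limsup P d \<le> ereal (2 powr (C * real k)))"
proof -
  have "\<exists>C. \<forall>k\<ge>1. \<forall>D L N. \<forall>A :: (nat \<Rightarrow> nat) set.
    finite D \<longrightarrow> card D = Suc (d - 1) \<longrightarrow> L \<in> D \<longrightarrow> A \<subseteq> PiE D (\<lambda>_. {..<N}) \<longrightarrow> \<not> has_minor 2 D L k A \<longrightarrow>
    card A \<le> 2 ^ (C * k) * N ^ (d - 1)" by (rule card_avoiding_bound)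
  then obtain C where "\<forall>k\<ge>1. \<forall>D L N. \<forall>A :: (nat \<Rightarrow> nat) set.
    finite D \<longrightarrow> card D = Suc (d - 1) \<longrightarrow> L \<in> D \<longrightarrow> A \<subseteq> PiE D (\<lambda>_. {..<N}) \<longrightarrow> \<not> has_minor 2 D L k A \<longrightarrow>
    card A \<le> 2 ^ (C * k) * N ^ (d - 1)" ..
  note C = this[rule_format]
  have "S_limsup P d \<le> ereal (2 powr (real (C + j) * real k))"
    if k: "k \<ge> 1" and P': "permutation_matrix d k P'" and "tuple_permutation_matrix d j P' P" for k P' P
  proof -
    obtain l where l: "l < d" and P: "P = kronecker P' (all_ones ((replicate d 1)[l := j]))"
      using \<open>tuple_permutation_matrix d j P' P\<close> by (auto simp: tuple_permutation_matrix_def)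
    have "\<exists>a. a \<in> ones P'" using P' k assms(1) unfolding permutation_matrix_def by fastforce
    moreover have "replicate d 0 \<in> positions ((replicate d 1)[l := j])"
      unfolding positions_def list_all2_conv_all_nth mem_Collect_eq
    proof (intro conjI allI impI)
      fix i assume "i < length (replicate d (0::nat))"
      then show "replicate d 0 ! i < (replicate d 1)[l := j] ! i"
        using assms(2) by (cases "i = l") auto
    qed simp
    ultimately have "ones P \<noteq> {}" by (auto simp: P kronecker_def all_ones_def)
    have extr: "extremal n P d \<le> j * (2 ^ (C * k) * n ^ (d - 1))" for n
    proof (rule extremal_le[OF \<open>ones P \<noteq> {}\<close>])
      fix A assume A: "is_matrix (replicate d n) A" and "avoids A P"
      let ?X = "{f \<in> PiE {..<d} (\<lambda>_. {..<n}). map f [0..<d] \<in> ones A}"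
      have "\<not> has_minor (Suc j) {..<d} l k ?X"
        using contains_tuple_permutation[OF P' l P A] \<open>avoids A P\<close> by blast
      moreover have "card B \<le> 2 ^ (C * k) * n ^ (d - 1)"
        if "B \<subseteq> PiE {..<d} (\<lambda>_. {..<n})" "\<not> has_minor 2 {..<d} l k B" for B
        by (rule C[OF k _ _ _ that]) (use l in auto)
      ultimately have "card ?X \<le> j * (2 ^ (C * k) * n ^ (d - 1))"
        using l assms(2) by (intro card_avoiding_Suc_minor[of "{..<d}" l _ n j k]) auto
      with card_ones_le[OF A] show "card (ones A) \<le> j * (2 ^ (C * k) * n ^ (d - 1))" by linarith
    qed
    have "real (extremal n P d) / real n ^ (d - 1) \<le> 2 powr (real (C + j) * real k)" for n
    proof -
      \<comment> \<open>The factor \<open>j\<close> from the residue classes is absorbed into the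
        exponent, which is why the constant is \<open>C + j\<close>.\<close>
      have "j \<le> j * k" using k by simp
      also have "\<dots> \<le> 2 ^ (j * k)" using less_exp by (rule less_imp_le)
      finally have "j * 2 ^ (C * k) \<le> 2 ^ (j * k) * 2 ^ (C * k)" by simp
      also have "\<dots> = (2::nat) ^ ((C + j) * k)" by (simp add: power_add[symmetric] algebra_simps)
      finally have "j * 2 ^ (C * k) \<le> 2 ^ ((C + j) * k)" .
      then have "real (j * 2 ^ (C * k)) \<le> real (2 ^ ((C + j) * k))" by (rule of_nat_mono)
      also have "\<dots> = 2 powr (real (C + j) * real k)"
        by (simp add: powr_realpow[symmetric] of_nat_mult[symmetric] del: of_nat_mult of_nat_add)
      finally have c: "real (j * 2 ^ (C * k)) \<le> 2 powr (real (C + j) * real k)" .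
      have "real (extremal n P d) \<le> real (j * 2 ^ (C * k)) * real n ^ (d - 1)"
        using extr[of n] by (metis mult.assoc of_nat_le_iff of_nat_mult of_nat_power)
      also have "\<dots> \<le> 2 powr (real (C + j) * real k) * real n ^ (d - 1)"
        using c by (intro mult_right_mono) auto
      finally show ?thesis
        \<comment> \<open>For \<open>n = 0\<close> and \<open>d > 1\<close> the quotient is 0 by
          convention, so the bound holds for every \<open>n\<close>.\<close>
        by (cases "real n ^ (d - 1) = 0") (auto simp: divide_le_eq zero_less_power_eq)
    qed
    then show ?thesis unfolding S_limsup_def by (intro Limsup_bounded always_eventually) auto
  qed
  then show ?thesis using assms(2) by (intro exI[of _ "real (C + j)"] conjI allI impI) auto
qed

end
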